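(* Let $k$ be a field and let $G=([n],E)$ be a graph. Then for every integer $d\geq 1$ with $d\ge \operatorname{pmd}(G)$ the ideal $L_G^{k}(d)$ is a radical complete intersection. In particular, $L_G^{k}(d)$ is prime if $d\ge \operatorname{pmd}(G)+1$.
   Context: Graphs are finite simple graphs; $[n]=\{1,\dots,n\}$. For a graph $G=(V,E)$, a field $k$ and an integer $d\ge 1$, let $S=k[y_{i,\ell} : i\in V,\ \ell\in[d]]$, and for every edge $e=\{i,j\}\in E$ put $f_e^{(d)}=\sum_{\ell=1}^d y_{i,\ell}\,y_{j,\ell}$. The Lovász–Saks–Schrijver ideal is $L_G^{k}(d)=(f_e^{(d)} : e\in E)\subseteq S$. An ideal is a complete intersection if it is generated by a regular sequence (the zero ideal counts); for $L_G^k(d)$ this is equivalent to the generators $f_e^{(d)}$, $e\in E$, forming a regular sequence in $S$. A positive matching of a graph $G=(V,E)$ is a matching $M\subseteq E$ (a set of pairwise disjoint edges) such that there is a weight function $w:V\to\mathbb{R}$ with $w(i)+w(j)>0$ for every $\{i,j\}\in M$ and $w(i)+w(j)<0$ for every $\{i,j\}\in E\setminus M$. A positive matching decomposition of $G$ is a partition $E=\bigcup_{i=1}^p E_i$ into pairwise disjoint subsets such that $E_i$ is a positive matching of the graph $(V,E\setminus\bigcup_{j=1}^{i-1}E_j)$ for $i=1,\dots,p$. The number $\operatorname{pmd}(G)$ is the smallest $p$ for which $G$ admits a positive matching decomposition with $p$ parts. *)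

theory Defs
  imports Complex_Main "HOL-Library.Poly_Mapping" "HOL-Library.Disjoint_Sets" "HOL-Algebra.Ideal"
begin

section \<open>Ideals in commutative rings\<close>

definition radical_of :: "('a, 'm) ring_scheme \<Rightarrow> 'a set \<Rightarrow> 'a set" where
  "radical_of R I = {a \<in> carrier R. \<exists>m::nat. a [^]\<^bsub>R\<^esub> m \<in> I}"

definition radical_ideal :: "'a set \<Rightarrow> ('a, 'm) ring_scheme \<Rightarrow> bool" where
  "radical_ideal I R \<longleftrightarrow> ideal I R \<and> radical_of R I = I"

text \<open>Each entry is a nonzerodivisor modulo the ideal generated by its predecessors, and the
  whole sequence generates a proper ideal.  The empty sequence is regular if \<open>R\<close> is nontrivial.\<close>

definition regular_sequence :: "('a, 'm) ring_scheme \<Rightarrow> 'a list \<Rightarrow> bool" where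
  "regular_sequence R fs \<longleftrightarrow>
     set fs \<subseteq> carrier R \<and>
     (\<forall>i<length fs. \<forall>a\<in>carrier R.
        fs ! i \<otimes>\<^bsub>R\<^esub> a \<in> genideal R (set (take i fs)) \<longrightarrow> a \<in> genideal R (set (take i fs))) \<and>
     genideal R (set fs) \<noteq> carrier R"

definition complete_intersection :: "'a set \<Rightarrow> ('a, 'm) ring_scheme \<Rightarrow> bool" where
  "complete_intersection I R \<longleftrightarrow> (\<exists>fs. regular_sequence R fs \<and> I = genideal R (set fs))"

section \<open>Polynomial rings in a set of variables\<close>

text \<open>A monomial is a finitely supported exponent vector, a polynomial a finitely supported
  family of coefficients.  The type has all elements of \<^typ>\<open>'x\<close> as variables; the carrier below
  cuts out the subring of polynomials involving only variables from \<open>X\<close>.\<close>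

type_synonym ('x, 'k) mpoly = "('x \<Rightarrow>\<^sub>0 nat) \<Rightarrow>\<^sub>0 'k"

definition pvar :: "'x \<Rightarrow> ('x, 'k::field) mpoly" where
  "pvar x = Poly_Mapping.single (Poly_Mapping.single x 1) 1"

definition poly_ring :: "'x set \<Rightarrow> ('x, 'k::field) mpoly ring" where
  "poly_ring X = \<lparr>carrier = {p. \<forall>m\<in>Poly_Mapping.keys p. Poly_Mapping.keys m \<subseteq> X},
     mult = (*), one = 1, zero = 0, add = (+)\<rparr>"

lemma cring_poly_ring: "cring (poly_ring X :: ('x, 'k::field) mpoly ring)"
proof -
  let ?R = "poly_ring X :: ('x, 'k) mpoly ring"
  have add_closed: "p + q \<in> carrier ?R" if "p \<in> carrier ?R" "q \<in> carrier ?R" for p q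
    using that Poly_Mapping.keys_add[of p q] by (auto simp: poly_ring_def)
  have mult_closed: "p * q \<in> carrier ?R" if p: "p \<in> carrier ?R" and q: "q \<in> carrier ?R" for p q
  proof -
    have "Poly_Mapping.keys m \<subseteq> X" if m: "m \<in> Poly_Mapping.keys (p * q)" for m
    proof -
      obtain a b where "m = a + b" "a \<in> Poly_Mapping.keys p" "b \<in> Poly_Mapping.keys q"
        using Poly_Mapping.keys_mult[of p q] m by auto
      then show ?thesis
        using p q Poly_Mapping.keys_add[of a b] unfolding poly_ring_def by simp blast
    qed
    then show ?thesis by (simp add: poly_ring_def)
  qed
  have one: "1 \<in> carrier ?R" by (auto simp: poly_ring_def)
  have uminus: "- p \<in> carrier ?R" if "p \<in> carrier ?R" for p
    using that by (simp add: poly_ring_def)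
  have zero: "0 \<in> carrier ?R" by (simp add: poly_ring_def)
  have ops: "p \<otimes>\<^bsub>?R\<^esub> q = p * q" "p \<oplus>\<^bsub>?R\<^esub> q = p + q" "\<one>\<^bsub>?R\<^esub> = 1" "\<zero>\<^bsub>?R\<^esub> = 0" for p q
    by (simp_all add: poly_ring_def)
  show ?thesis
  proof (rule cringI)
    show "abelian_group ?R"
      by (rule abelian_groupI; unfold ops)
        (auto intro: add_closed zero ac_simps uminus bexI[of _ "- p" for p])
    show "comm_monoid ?R"
      by (rule comm_monoidI; unfold ops) (auto intro: mult_closed one ac_simps)
  qed (unfold ops, rule distrib_right)
qed

section \<open>Graphs and positive matching decompositions\<close>

definition simple_graph :: "'v set \<Rightarrow> 'v set set \<Rightarrow> bool" where
  "simple_graph V E \<longleftrightarrow> finite V \<and> (\<forall>e\<in>E. \<exists>i\<in>V. \<exists>j\<in>V. i \<noteq> j \<and> e = {i, j})"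

text \<open>For an edge \<open>e = {i, j}\<close> the sum \<open>\<Sum>v\<in>e. w v\<close> is \<open>w i + w j\<close>.  The vertex set does not occur:
  the condition only depends on the weights of endpoints of edges.\<close>

definition positive_matching :: "'v set set \<Rightarrow> 'v set set \<Rightarrow> bool" where
  "positive_matching E M \<longleftrightarrow> M \<subseteq> E \<and> disjoint M \<and>
     (\<exists>w :: 'v \<Rightarrow> real. (\<forall>e\<in>M. (\<Sum>v\<in>e. w v) > 0) \<and> (\<forall>e\<in>E - M. (\<Sum>v\<in>e. w v) < 0))"

definition positive_matching_decomposition :: "'v set set \<Rightarrow> nat \<Rightarrow> (nat \<Rightarrow> 'v set set) \<Rightarrow> bool" where
  "positive_matching_decomposition E p P \<longleftrightarrow>
     disjoint_family_on P {1..p} \<and> E = (\<Union>i\<in>{1..p}. P i) \<and>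
     (\<forall>i\<in>{1..p}. positive_matching (E - (\<Union>j\<in>{1..<i}. P j)) (P i))"

definition pmd :: "'v set set \<Rightarrow> nat" where
  "pmd E = (LEAST p. \<exists>P. positive_matching_decomposition E p P)"

text \<open>Splitting off one edge at a time gives a decomposition, so the minimum exists.\<close>

lemma positive_matching_decomposition_exists:
  assumes G: "simple_graph V E"
  shows "\<exists>p P. positive_matching_decomposition E p P"
proof -
  have "E \<subseteq> Pow V" "finite V" using G by (auto simp: simple_graph_def)
  then have "finite E" by (meson finite_Pow_iff finite_subset)
  then obtain es where es: "set es = E" "distinct es" by (metis finite_distinct_list)
  define P where "P i = {es ! (i - 1)}" for i
  have single: "positive_matching F {e}" if e: "e \<in> F" and F: "F \<subseteq> E" for e F
  proof -
    define w :: "'a \<Rightarrow> real" where "w v = (if v \<in> e then 1 else - 2)" for v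
    have "(\<Sum>v\<in>e. w v) > 0"
    proof -
      obtain i j where "i \<noteq> j" "e = {i, j}" using e F G unfolding simple_graph_def by blast
      then show ?thesis by (simp add: w_def)
    qed
    moreover have "(\<Sum>v\<in>e'. w v) < 0" if e': "e' \<in> F - {e}" for e'
    proof -
      obtain i j where ij: "i \<noteq> j" "e = {i, j}" using e F G unfolding simple_graph_def by blast
      obtain a b where ab: "a \<noteq> b" "e' = {a, b}" using e' F G unfolding simple_graph_def by blast
      have "a \<notin> e \<or> b \<notin> e" using ij ab e' by auto
      then show ?thesis using ab by (auto simp: w_def)
    qed
    ultimately show ?thesis
      using e by (auto simp: positive_matching_def disjoint_def intro!: exI[of _ w])
  qed
  have "positive_matching_decomposition E (length es) P"
    unfolding positive_matching_decomposition_def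
  proof (intro conjI ballI)
    show "disjoint_family_on P {1..length es}"
      using es(2) by (auto simp: disjoint_family_on_def P_def nth_eq_iff_index_eq)
    have "E = (\<lambda>i. es ! i) ` {..<length es}" using es(1) by (auto simp: set_conv_nth)
    also have "{..<length es} = (\<lambda>i. i - 1) ` {1..length es}"
      by (auto simp: image_iff intro!: bexI[of _ "Suc _"])
    finally show "E = (\<Union>i\<in>{1..length es}. P i)" by (auto simp: P_def)
  next
    fix i assume i: "i \<in> {1..length es}"
    have "es ! (i - 1) \<in> E - (\<Union>j\<in>{1..<i}. P j)"
      using i es by (auto simp: P_def nth_eq_iff_index_eq)
    then show "positive_matching (E - (\<Union>j\<in>{1..<i}. P j)) (P i)"
      unfolding P_def[of i] by (intro single) auto
  qed
  then show ?thesis by blast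
qed

section \<open>Lovasz--Saks--Schrijver ideals\<close>

text \<open>The variable \<open>y\<^sub>i\<^sub>,\<^sub>l\<close> is \<open>pvar (i, l)\<close>.\<close>

definition LSS_ring :: "'v set \<Rightarrow> nat \<Rightarrow> ('v \<times> nat, 'k::field) mpoly ring" where
  "LSS_ring V d = poly_ring (V \<times> {1..d})"

text \<open>For \<open>e = {i, j}\<close> the product over \<open>e\<close> is \<open>y\<^sub>i\<^sub>,\<^sub>l * y\<^sub>j\<^sub>,\<^sub>l\<close>.\<close>

definition LSS_poly :: "nat \<Rightarrow> 'v set \<Rightarrow> ('v \<times> nat, 'k::field) mpoly" where
  "LSS_poly d e = (\<Sum>l=1..d. \<Prod>i\<in>e. pvar (i, l))"

definition LSS_ideal :: "'v set \<Rightarrow> 'v set set \<Rightarrow> nat \<Rightarrow> ('v \<times> nat, 'k::field) mpoly set" where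
  "LSS_ideal V E d = genideal (LSS_ring V d) (LSS_poly d ` E)"

text \<open>Since \<^const>\<open>genideal\<close> is an intersection of ideals containing the generators, it is
  meaningful only for generators in the carrier.\<close>

lemma LSS_poly_in_carrier:
  assumes G: "simple_graph V E" and e: "e \<in> E"
  shows "(LSS_poly d e :: ('v \<times> nat, 'k::field) mpoly) \<in> carrier (LSS_ring V d)"
proof -
  let ?R = "LSS_ring V d :: ('v \<times> nat, 'k) mpoly ring"
  interpret cring ?R unfolding LSS_ring_def by (rule cring_poly_ring)
  have mult: "a * b \<in> carrier ?R" if "a \<in> carrier ?R" "b \<in> carrier ?R" for a b
    using m_closed[OF that] by (simp add: LSS_ring_def poly_ring_def)
  have add: "a + b \<in> carrier ?R" if "a \<in> carrier ?R" "b \<in> carrier ?R" for a b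
    using a_closed[OF that] by (simp add: LSS_ring_def poly_ring_def)
  have zero: "0 \<in> carrier ?R" by (simp add: LSS_ring_def poly_ring_def)
  obtain i j where ij: "i \<in> V" "j \<in> V" "i \<noteq> j" "e = {i, j}"
    using G e unfolding simple_graph_def by blast
  have var: "pvar (v, l) \<in> carrier ?R" if "v \<in> V" "l \<in> {1..d}" for v l
    using that by (simp add: LSS_ring_def poly_ring_def pvar_def)
  have sum: "(\<Sum>l\<in>A. \<Prod>i\<in>e. pvar (i, l)) \<in> carrier ?R" if "finite A" "A \<subseteq> {1..d}" for A
    using that
  proof (induction A rule: finite_induct)
    case empty
    then show ?case using zero by simp
  next
    case (insert l A)
    have "(\<Prod>i\<in>e. pvar (i, l)) \<in> carrier ?R"
      using ij insert.prems by (auto intro!: mult var)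
    then show ?case using insert by (auto intro!: add)
  qed
  show ?thesis unfolding LSS_poly_def by (rule sum) auto
qed

end

theory Submission
  imports Defs "HOL-Library.Product_Lexorder" "Jordan_Normal_Form.Determinant"
begin

text \<open>The proof degenerates the ideal to one generated by monomials.  Let \<open>E\<close> have a positive matching
decomposition with \<open>p\<close> parts, and read it as an edge colouring \<open>c\<close> with the colours \<open>1..p\<close>.  The
weights \<open>w\<^sub>l\<close> that witness the parts, scaled by rapidly decreasing factors \<open>K^(p - l)\<close>, give a weight
on the variables \<open>y\<^sub>i\<^sub>,\<^sub>l\<close> for which the term of \<open>f\<^sub>e\<close> of largest weight is the single monomial
\<open>\<Prod>i\<in>e. y\<^sub>i\<^sub>,\<^sub>l\<close> with \<open>l = c e\<close>: layers after \<open>c e\<close> are dominated by the scaling, and in the layers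
before \<open>c e\<close> the edge \<open>e\<close> is still unmatched and has negative weight.  Since every colour class is a
matching, these monomials have pairwise disjoint supports and are squarefree, so they form a regular
sequence and generate a radical ideal.  Both properties pass from initial forms to the polynomials
themselves, because an element can be corrected by elements of the ideal one weight at a time
(\<open>degenerates_nzd_mod\<close>, \<open>degenerates_insert\<close>, \<open>degenerates_radical_mod\<close>).

For primality there is a layer \<open>z\<close> that no edge uses as its colour.  Vertices are attached one at a
time.  Let \<open>v\<close> be the new vertex, \<open>u\<^sub>1, \<dots>, u\<^sub>t\<close> its neighbours among the old ones and \<open>k\<^sub>a\<close> the
colour of \<open>{v, u\<^sub>a}\<close>; these colours are distinct.  The new generators are \<open>t\<close> linear equations for the
\<open>d > t\<close> coordinates of \<open>y\<^sub>v\<close>.  Inverting the minor \<open>\<Delta> = det (y\<^sub>u\<^sub>a\<^sub>,\<^sub>k\<^sub>b)\<close> they can be solved by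
Cramer's rule, so that the enlarged ideal is prime as soon as \<open>\<Delta>\<close> is a nonzerodivisor modulo it
(\<open>prime_mod_attach_vertex\<close>).  This is again checked on initial forms.  The variables of \<open>v\<close> do not occur
in the old generators, hence their weights can be chosen so that the initial form of the generator for
\<open>{v, u\<^sub>a}\<close> is the binomial with the layers \<open>k\<^sub>a\<close> and \<open>z\<close>, while that of \<open>\<Delta>\<close> is the product of the
diagonal variables \<open>y\<^sub>u\<^sub>a\<^sub>,\<^sub>k\<^sub>a\<close>.  A second degeneration shows that each diagonal variable is a
nonzerodivisor: recolour the edge \<open>{v, u\<^sub>a}\<close> with \<open>z\<close>, which keeps the colouring proper and makes the
variable coprime to all initial monomials (\<open>LSS_prime_insert_vertex\<close>).

All of this takes place in the ring of polynomials in all variables of a type; setting the other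
variables to zero transfers the results to finitely many variables (\<open>genideal_poly_ring\<close>).\<close>

section \<open>Ideals, nonzerodivisors and weights\<close>

interpretation idl: Modules.module "(*) :: 'a::comm_ring_1 \<Rightarrow> 'a \<Rightarrow> 'a"
  by standard (simp_all add: algebra_simps)

abbreviation "lookup \<equiv> Poly_Mapping.lookup"
abbreviation "keys \<equiv> Poly_Mapping.keys"

lemma span_mult_right: "x \<in> idl.span S \<Longrightarrow> x * c \<in> idl.span S"
  using idl.span_scale[of x S c] by (simp add: mult.commute)

definition nzd_mod :: "'a::comm_ring_1 set \<Rightarrow> 'a \<Rightarrow> bool" where
  "nzd_mod I f \<longleftrightarrow> (\<forall>a. f * a \<in> I \<longrightarrow> a \<in> I)"

definition radical_mod :: "'a::comm_ring_1 set \<Rightarrow> bool" where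
  "radical_mod I \<longleftrightarrow> (\<forall>a m. a ^ m \<in> I \<longrightarrow> a \<in> I)"

text \<open>The unit ideal counts as prime; properness is treated separately, in \<open>one_notin_span_LSS\<close>.\<close>

definition prime_mod :: "'a::comm_ring_1 set \<Rightarrow> bool" where
  "prime_mod I \<longleftrightarrow> (\<forall>a b. a * b \<in> I \<longrightarrow> a \<in> I \<or> b \<in> I)"

lemma nzd_mod_mult: "nzd_mod I f \<Longrightarrow> nzd_mod I g \<Longrightarrow> nzd_mod I (f * g)"
  unfolding nzd_mod_def mult.assoc by blast

lemma nzd_mod_one: "nzd_mod I 1"
  by (simp add: nzd_mod_def)

lemma nzd_mod_prod: "(\<And>b. b \<in> B \<Longrightarrow> nzd_mod I (f b)) \<Longrightarrow> nzd_mod I (\<Prod>b\<in>B. f b)"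
  by (induction B rule: infinite_finite_induct) (auto intro: nzd_mod_mult nzd_mod_one)

lemma nzd_mod_power: "nzd_mod I f \<Longrightarrow> nzd_mod I (f ^ k)"
  by (induction k) (auto intro: nzd_mod_mult nzd_mod_one)

lemma cong_prod_mod:
  assumes "\<And>x. x \<in> A \<Longrightarrow> f x - g x \<in> idl.span S"
  shows "(\<Prod>x\<in>A. f x) - (\<Prod>x\<in>A. g x) \<in> idl.span S"
  using assms
proof (induction A rule: infinite_finite_induct)
  case (insert x A)
  have "f x * (\<Prod>x\<in>A. f x) - g x * (\<Prod>x\<in>A. g x)
      = f x * ((\<Prod>x\<in>A. f x) - (\<Prod>x\<in>A. g x)) + (f x - g x) * (\<Prod>x\<in>A. g x)"
    by (simp add: algebra_simps)
  also have "\<dots> \<in> idl.span S"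
    using insert by (intro idl.span_add idl.span_scale span_mult_right) auto
  finally show ?case using insert by simp
qed (simp_all add: idl.span_zero)

lemma cong_power_mod: "a - b \<in> idl.span S \<Longrightarrow> a ^ k - b ^ k \<in> idl.span S"
  using cong_prod_mod[of "{..<k}" "\<lambda>_. a" "\<lambda>_. b" S] by simp

text \<open>The part of a polynomial supported on the monomials satisfying a predicate.  It serves for three
purposes: homogeneous components, setting variables to zero, and extracting the constant term.\<close>

lift_definition restr :: "('m \<Rightarrow> bool) \<Rightarrow> ('m \<Rightarrow>\<^sub>0 'k::zero) \<Rightarrow> 'm \<Rightarrow>\<^sub>0 'k"
  is "\<lambda>P f m. if P m then f m else 0"
  by (rule finite_subset[rotated]) auto

lemma lookup_restr: "lookup (restr P p) m = (if P m then lookup p m else 0)"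
  by transfer simp

lemma keys_restr: "keys (restr P p) = {m \<in> keys p. P m}"
  by (auto simp: in_keys_iff lookup_restr split: if_splits)

lemma restr_zero [simp]: "restr P 0 = 0"
  by (rule poly_mapping_eqI) (simp add: lookup_restr)

lemma restr_add: "restr P (p + q) = restr P p + restr P q"
  by (rule poly_mapping_eqI) (simp add: lookup_restr lookup_add)

lemma restr_diff: "restr P (p - q) = restr P p - restr P (q :: _ \<Rightarrow>\<^sub>0 _::ab_group_add)"
  by (rule poly_mapping_eqI) (simp add: lookup_restr lookup_minus)

lemma restr_sum: "restr P (\<Sum>x\<in>A. f x) = (\<Sum>x\<in>A. restr P (f x))"
  by (induction A rule: infinite_finite_induct) (simp_all add: restr_add)

lemma restr_eq_self: "(\<And>m. m \<in> keys p \<Longrightarrow> P m) \<Longrightarrow> restr P p = p"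
  by (rule poly_mapping_eqI) (auto simp: lookup_restr in_keys_iff)

lemma restr_eq_zero: "(\<And>m. m \<in> keys p \<Longrightarrow> \<not> P m) \<Longrightarrow> restr P p = 0"
  by (rule poly_mapping_eqI) (auto simp: lookup_restr in_keys_iff)

lemma restr_split: "p = restr P p + restr (\<lambda>m. \<not> P m) (p :: _ \<Rightarrow>\<^sub>0 _::monoid_add)"
  by (rule poly_mapping_eqI) (simp add: lookup_restr lookup_add)

lemma keys_multE:
  assumes "m \<in> keys (p * q)"
  obtains a b where "m = a + b" "a \<in> keys p" "b \<in> keys q"
  using assms Poly_Mapping.keys_mult[of p q] by auto

text \<open>If \<open>P\<close> cuts out a divisor-closed submonoid of the monomials, the other monomials span an ideal, and
restriction is the projection modulo this ideal.\<close>

lemma restr_mult_hom: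
  fixes p q :: "('m::comm_monoid_add) \<Rightarrow>\<^sub>0 ('k::comm_ring_1)"
  assumes P: "\<And>a b. P (a + b) \<longleftrightarrow> P a \<and> P b"
  shows "restr P (p * q) = restr P p * restr P q"
proof -
  let ?N = "\<lambda>m. \<not> P m"
  have "p * q = restr P p * q + restr ?N p * q"
    by (subst restr_split[of p P]) (rule distrib_right)
  also have "restr P p * q = restr P p * restr P q + restr P p * restr ?N q"
    by (subst restr_split[of q P]) (rule distrib_left)
  finally have "p * q = restr P p * restr P q + (restr P p * restr ?N q + restr ?N p * q)"
    by (simp only: add.assoc)
  moreover have "restr P (restr P p * restr P q) = restr P p * restr P q"
    by (rule restr_eq_self) (auto elim!: keys_multE simp: keys_restr P)
  moreover have "restr P (restr P p * restr ?N q) = 0"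
    by (rule restr_eq_zero) (auto elim!: keys_multE simp: keys_restr P)
  moreover have "restr P (restr ?N p * q) = 0"
    by (rule restr_eq_zero) (auto elim!: keys_multE simp: keys_restr P)
  ultimately show ?thesis by (simp add: restr_add)
qed

definition wt :: "('x \<Rightarrow> nat) \<Rightarrow> ('x \<Rightarrow>\<^sub>0 nat) \<Rightarrow> nat" where
  "wt W m = (\<Sum>x\<in>keys m. W x * lookup m x)"

lemma wt_superset:
  assumes "finite A" "keys m \<subseteq> A"
  shows "wt W m = (\<Sum>x\<in>A. W x * lookup m x)"
  unfolding wt_def by (rule sum.mono_neutral_left) (use assms in \<open>auto simp: in_keys_iff\<close>)

lemma wt_add: "wt W (a + b) = wt W a + wt W b"
proof -
  let ?A = "keys a \<union> keys b"
  have "keys (a + b) \<subseteq> ?A" by (rule Poly_Mapping.keys_add)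
  then show ?thesis
    by (simp add: wt_superset[of ?A] lookup_add distrib_left sum.distrib)
qed

lemma wt_zero [simp]: "wt W 0 = 0"
  by (simp add: wt_def)

lemma wt_single [simp]: "wt W (Poly_Mapping.single x k) = W x * k"
  by (cases "k = 0") (simp_all add: wt_def)

text \<open>The component of weight \<open>n\<close>; when all monomials have weight less than \<open>n + 1\<close> this is the initial form
or zero.  The strict bound in \<open>wless\<close> makes \<open>wless W 0 p\<close> equivalent to \<open>p = 0\<close>, the start of the
inductions on the weight.\<close>

definition wpart :: "('x \<Rightarrow> nat) \<Rightarrow> nat \<Rightarrow> ('x, 'k::comm_ring_1) mpoly \<Rightarrow> ('x, 'k) mpoly" where
  "wpart W n = restr (\<lambda>m. wt W m = n)"

definition wless :: "('x \<Rightarrow> nat) \<Rightarrow> nat \<Rightarrow> ('x, 'k::comm_ring_1) mpoly \<Rightarrow> bool" where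
  "wless W n p \<longleftrightarrow> (\<forall>m\<in>keys p. wt W m < n)"

definition homog :: "('x \<Rightarrow> nat) \<Rightarrow> nat \<Rightarrow> ('x, 'k::comm_ring_1) mpoly \<Rightarrow> bool" where
  "homog W n p \<longleftrightarrow> (\<forall>m\<in>keys p. wt W m = n)"

lemma wpart_zero [simp]: "wpart W n 0 = 0"
  by (simp add: wpart_def)

lemma wpart_add: "wpart W n (p + q) = wpart W n p + wpart W n q"
  by (simp add: wpart_def restr_add)

lemma wpart_diff: "wpart W n (p - q) = wpart W n p - wpart W n q"
  by (simp add: wpart_def restr_diff)

lemma wpart_sum: "wpart W n (\<Sum>x\<in>A. f x) = (\<Sum>x\<in>A. wpart W n (f x))"
  by (simp add: wpart_def restr_sum)

lemma homog_wpart: "homog W n (wpart W n p)"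
  by (simp add: homog_def wpart_def keys_restr)

lemma wpart_homog: "homog W n p \<Longrightarrow> wpart W k p = (if k = n then p else 0)"
  unfolding homog_def wpart_def by (auto intro: restr_eq_self restr_eq_zero)

lemma homog_imp_wless: "homog W n p \<Longrightarrow> wless W (Suc n) p"
  by (auto simp: homog_def wless_def)

lemma homog_zero [simp]: "homog W n 0"
  by (simp add: homog_def)

lemma homog_one [simp]: "homog W 0 1"
  by (simp add: homog_def)

lemma homog_add: "homog W n p \<Longrightarrow> homog W n q \<Longrightarrow> homog W n (p + q)"
  using Poly_Mapping.keys_add[of p q] by (auto simp: homog_def)

lemma homog_uminus: "homog W n p \<Longrightarrow> homog W n (- p)"
  by (simp add: homog_def in_keys_iff)

lemma homog_sum: "(\<And>x. x \<in> A \<Longrightarrow> homog W n (f x)) \<Longrightarrow> homog W n (\<Sum>x\<in>A. f x)"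
  by (induction A rule: infinite_finite_induct) (auto intro: homog_add)

lemma homog_mult: "homog W a p \<Longrightarrow> homog W b q \<Longrightarrow> homog W (a + b) (p * q)"
  by (auto simp: homog_def wt_add elim!: keys_multE)

lemma homog_prod:
  "(\<And>x. x \<in> A \<Longrightarrow> homog W (n x) (f x)) \<Longrightarrow> homog W (\<Sum>x\<in>A. n x) (\<Prod>x\<in>A. f x)"
  by (induction A rule: infinite_finite_induct) (auto intro: homog_mult)

lemma homog_power: "homog W a p \<Longrightarrow> homog W (a * k) (p ^ k)"
  using homog_prod[of "{..<k}" W "\<lambda>_. a" "\<lambda>_. p"] by (simp add: mult.commute)

lemma homog_pvar: "homog W (W x) (pvar x)"
  by (simp add: homog_def pvar_def)

lemma wless_mono: "wless W n p \<Longrightarrow> n \<le> k \<Longrightarrow> wless W k p"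
  by (auto simp: wless_def)

lemma wless_zero [simp]: "wless W n 0"
  by (simp add: wless_def)

lemma wless_add: "wless W n p \<Longrightarrow> wless W n q \<Longrightarrow> wless W n (p + q)"
  using Poly_Mapping.keys_add[of p q] by (auto simp: wless_def)

lemma wless_diff: "wless W n p \<Longrightarrow> wless W n q \<Longrightarrow> wless W n (p - q)"
  using keys_diff[of p q] by (auto simp: wless_def)

lemma wless_sum: "(\<And>x. x \<in> A \<Longrightarrow> wless W n (f x)) \<Longrightarrow> wless W n (\<Sum>x\<in>A. f x)"
  by (induction A rule: infinite_finite_induct) (auto intro: wless_add)

lemma wless_zero_iff: "wless W 0 p \<longleftrightarrow> p = 0"
  by (auto simp: wless_def)

lemma wless_mult: "wless W (Suc a) p \<Longrightarrow> wless W b q \<Longrightarrow> wless W (a + b) (p * q)"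
  by (fastforce simp: wless_def wt_add less_Suc_eq_le elim!: keys_multE)

lemma wless_exists: "\<exists>n. wless W n p"
proof
  show "wless W (Suc (\<Sum>m\<in>keys p. wt W m)) p"
    by (auto simp: wless_def less_Suc_eq_le intro: member_le_sum)
qed

lemma wless_Suc_wpart_zero: "wless W (Suc n) p \<Longrightarrow> wpart W n p = 0 \<Longrightarrow> wless W n p"
proof -
  assume a: "wless W (Suc n) p" "wpart W n p = 0"
  have "keys (wpart W n p) = {}" using a by simp
  then show ?thesis using a(1) by (fastforce simp: wless_def wpart_def keys_restr less_Suc_eq)
qed

lemma wpart_wless: "wless W n p \<Longrightarrow> n \<le> k \<Longrightarrow> wpart W k p = 0"
  unfolding wless_def wpart_def by (rule restr_eq_zero) auto

lemma wless_minus_wpart: "wless W (Suc n) p \<Longrightarrow> wless W n (p - wpart W n p)"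
  by (rule wless_Suc_wpart_zero)
    (auto intro: wless_diff homog_imp_wless homog_wpart simp: wpart_diff wpart_homog[OF homog_wpart])

lemma sum_wpart:
  assumes "wless W n p"
  shows "p = (\<Sum>k<n. wpart W k p)"
proof (rule poly_mapping_eqI)
  fix m
  show "lookup p m = lookup (\<Sum>k<n. wpart W k p) m"
    using assms
    by (auto simp: lookup_sum wpart_def lookup_restr wless_def in_keys_iff)
qed

text \<open>Initial forms multiply: every product involving a term below the top has smaller weight.\<close>

lemma wpart_mult_top:
  assumes p: "wless W (Suc a) p" and q: "wless W (Suc b) q"
  shows "wpart W (a + b) (p * q) = wpart W a p * wpart W b q"
proof -
  let ?p = "p - wpart W a p" and ?q = "q - wpart W b q"
  have "p * q = wpart W a p * wpart W b q + (wpart W a p * ?q + ?p * q)"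
    by (simp add: algebra_simps)
  moreover have "wpart W (a + b) (wpart W a p * wpart W b q) = wpart W a p * wpart W b q"
    by (simp add: wpart_homog[OF homog_mult[OF homog_wpart homog_wpart]])
  moreover have "wpart W (a + b) (wpart W a p * ?q) = 0"
    using wless_mult[OF homog_imp_wless[OF homog_wpart] wless_minus_wpart[OF q]] by (rule wpart_wless) simp
  moreover have "wless W (a + b) (?p * q)"
    using wless_mult[OF q wless_minus_wpart[OF p]] by (simp add: ac_simps)
  then have "wpart W (a + b) (?p * q) = 0"
    by (rule wpart_wless) simp
  ultimately show ?thesis by (simp add: wpart_add)
qed

lemma wpart_mult_homog:
  assumes g: "homog W w g"
  shows "wpart W n (a * g) = (if w \<le> n then wpart W (n - w) a * g else 0)"
proof -
  obtain N where N: "wless W N a" using wless_exists by blast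
  have "wpart W n (a * g) = (\<Sum>k<N. wpart W n (wpart W k a * g))"
    by (subst sum_wpart[OF N]) (simp add: wpart_sum sum_distrib_right)
  also have "\<dots> = (\<Sum>k<N. if n = k + w then wpart W k a * g else 0)"
    by (rule sum.cong) (simp_all add: wpart_homog[OF homog_mult[OF homog_wpart g]])
  also have "\<dots> = (if w \<le> n then wpart W (n - w) a * g else 0)"
  proof (cases "w \<le> n")
    case True
    then have "(\<Sum>k<N. if n = k + w then wpart W k a * g else 0)
        = (\<Sum>k<N. if k = n - w then wpart W k a * g else 0)"
      by (intro sum.cong) auto
    then show ?thesis using True by (auto simp: wpart_wless[OF N])
  qed (auto intro!: sum.neutral)
  finally show ?thesis .
qed

lemma wpart_span_homog:
  assumes "\<And>g. g \<in> S \<Longrightarrow> \<exists>w. homog W w g" and "p \<in> idl.span S"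
  shows "wpart W n p \<in> idl.span S"
  using assms(2)
proof (induction rule: idl.span_induct_alt)
  case base
  then show ?case by (simp add: idl.span_zero)
next
  case (step c x y)
  then obtain w where "homog W w x" using assms(1) by blast
  then have "wpart W n (c * x) \<in> idl.span S"
    using idl.span_base[OF step.hyps(1)] by (simp add: wpart_mult_homog idl.span_zero idl.span_scale)
  then show ?case using step by (simp add: wpart_add idl.span_add)
qed

section \<open>Degeneration to initial ideals\<close>

text \<open>\<open>J\<close> is the ideal of initial forms of \<open>I\<close>: initial forms of elements of \<open>I\<close> lie in \<open>J\<close>, and conversely
\<open>J\<close> is homogeneous and each homogeneous element of it is such an initial form.\<close>

definition degenerates :: "('x \<Rightarrow> nat) \<Rightarrow> ('x, 'k::comm_ring_1) mpoly set \<Rightarrow> ('x, 'k) mpoly set \<Rightarrow> bool" where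
  "degenerates W I J \<longleftrightarrow>
     (\<forall>h\<in>I. \<forall>n. wless W (Suc n) h \<longrightarrow> wpart W n h \<in> J) \<and>
     (\<forall>g\<in>J. \<forall>n. wpart W n g \<in> J \<and> (\<exists>h\<in>I. wless W (Suc n) h \<and> wpart W n h = wpart W n g))"

lemma degenerates_top: "degenerates W I J \<Longrightarrow> h \<in> I \<Longrightarrow> wless W (Suc n) h \<Longrightarrow> wpart W n h \<in> J"
  by (simp add: degenerates_def)

text \<open>The correction step behind all lifting arguments: an element whose initial form lies in \<open>J\<close> has smaller
weight modulo \<open>I\<close>.\<close>

lemma degenerates_reduce:
  assumes "degenerates W I J" "wless W (Suc n) a" "wpart W n a \<in> J"
  obtains b where "b \<in> I" "wless W (Suc n) b" "wless W n (a - b)"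
proof -
  \<comment> \<open>the initial form of \<open>a\<close> is itself homogeneous, so taking its component again changes nothing\<close>
  obtain b where b: "b \<in> I" "wless W (Suc n) b" "wpart W n b = wpart W n (wpart W n a)"
    using assms(1,3) unfolding degenerates_def by blast
  then have "wless W n (a - b)"
    by (intro wless_Suc_wpart_zero[of W n "a - b"] wless_diff assms)
      (simp_all add: wpart_diff wpart_homog[OF homog_wpart])
  then show ?thesis using that b by blast
qed

text \<open>If \<open>f * a\<close> lies in the ideal, then the initial form of \<open>f\<close> kills that of \<open>a\<close> modulo \<open>J\<close>, so \<open>a\<close> can be
reduced to smaller weight without leaving the situation.\<close>

lemma degenerates_nzd_mod:
  assumes D: "degenerates W (idl.span S) J" and f: "wless W (Suc w) f" and g: "nzd_mod J (wpart W w f)"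
  shows "nzd_mod (idl.span S) f"
proof -
  have "a \<in> idl.span S" if "wless W n a" "f * a \<in> idl.span S" for n a
    using that
  proof (induction n arbitrary: a)
    case 0
    then show ?case by (simp add: wless_zero_iff idl.span_zero)
  next
    case (Suc n)
    have "wless W (Suc (w + n)) (f * a)"
      using wless_mult[OF f Suc.prems(1)] by simp
    from degenerates_top[OF D Suc.prems(2) this] have "wpart W w f * wpart W n a \<in> J"
      by (simp add: wpart_mult_top[OF f Suc.prems(1)])
    then have "wpart W n a \<in> J" using g by (simp add: nzd_mod_def)
    then obtain b where b: "b \<in> idl.span S" "wless W n (a - b)"
      using degenerates_reduce[OF D Suc.prems(1)] by metis
    have "f * (a - b) \<in> idl.span S"
      using Suc.prems(2) b(1) by (simp add: right_diff_distrib idl.span_diff idl.span_scale)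
    then have "(a - b) + b \<in> idl.span S"
      using Suc.IH b by (intro idl.span_add) auto
    then show ?case by simp
  qed
  then show ?thesis using wless_exists unfolding nzd_mod_def by blast
qed

text \<open>The initial form of \<open>a ^ k\<close> is the \<open>k\<close>-th power of that of \<open>a\<close>; reduce \<open>a\<close> modulo the ideal and repeat.\<close>

lemma degenerates_radical_mod:
  assumes D: "degenerates W (idl.span S) J" and J: "radical_mod J"
  shows "radical_mod (idl.span S)"
proof -
  have "a \<in> idl.span S" if "wless W n a" "a ^ k \<in> idl.span S" for n a k
    using that
  proof (induction n arbitrary: a)
    case 0
    then show ?case by (simp add: wless_zero_iff idl.span_zero)
  next
    case (Suc n)
    have "wless W (Suc (n * j)) (a ^ j) \<and> wpart W (n * j) (a ^ j) = wpart W n a ^ j" for j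
    proof (induction j)
      case 0
      then show ?case
        using homog_imp_wless[OF homog_one] by (simp add: wpart_homog[OF homog_one])
    next
      case (Suc j)
      then show ?case
        using wless_mult[OF \<open>wless W (Suc n) a\<close>, of "Suc (n * j)" "a ^ j"]
          wpart_mult_top[OF \<open>wless W (Suc n) a\<close>, of "n * j" "a ^ j"] by simp
    qed
    then have "wpart W n a ^ k \<in> J" using degenerates_top[OF D Suc.prems(2)] by metis
    then have "wpart W n a \<in> J" using J by (auto simp: radical_mod_def)
    then obtain b where b: "b \<in> idl.span S" "wless W n (a - b)"
      using degenerates_reduce[OF D Suc.prems(1)] by metis
    have "(a - b) ^ k - a ^ k \<in> idl.span S"
      using b(1) by (intro cong_power_mod) (simp add: idl.span_neg)
    then have "(a - b) ^ k \<in> idl.span S"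
      using idl.span_add[OF _ Suc.prems(2)] by fastforce
    then have "(a - b) + b \<in> idl.span S"
      using Suc.IH b by (intro idl.span_add) auto
    then show ?case by simp
  qed
  then show ?thesis using wless_exists unfolding radical_mod_def by blast
qed

text \<open>No unexpected initial forms appear when a generator is added whose initial form is a nonzerodivisor.  If
in \<open>h = h' + c * f\<close> the top parts cancel, then the initial form of \<open>c\<close> is killed modulo the old initial
ideal, and \<open>c\<close> can be replaced by something smaller; hence a representation without cancellation exists.\<close>

lemma degenerates_insert:
  assumes D: "degenerates W (idl.span S) (idl.span T)" and f: "wless W (Suc w) f"
    and g: "nzd_mod (idl.span T) (wpart W w f)"
  shows "degenerates W (idl.span (insert f S)) (idl.span (insert (wpart W w f) T))"
  unfolding degenerates_def
proof (intro conjI ballI allI impI)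
  let ?g = "wpart W w f"
  have mono: "idl.span T \<subseteq> idl.span (insert ?g T)" "idl.span S \<subseteq> idl.span (insert f S)"
    by (rule idl.span_mono, blast)+
  have base: "c * ?g \<in> idl.span (insert ?g T)" "c * f \<in> idl.span (insert f S)" for c
    by (auto intro: idl.span_scale idl.span_base)
  {
    fix h n assume h: "h \<in> idl.span (insert f S)" and hn: "wless W (Suc n) h"
    \<comment> \<open>lower the weight of the cofactor until \<open>c * f\<close> no longer exceeds the weight of \<open>h\<close>\<close>
    have lower: "\<exists>c'. h - c' * f \<in> idl.span S \<and> wless W (Suc n - w) c'"
      if "wless W N c" "h - c * f \<in> idl.span S" for N c
      using that
    proof (induction N arbitrary: c)
      case 0
      then show ?case by (metis wless_mono zero_le)
    next
      case (Suc N)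
      show ?case
      proof (cases "Suc N \<le> Suc n - w")
        case True
        then show ?thesis using Suc.prems wless_mono by blast
      next
        case False
        then have N: "Suc n \<le> N + w" by simp
        have cf: "wless W (Suc (N + w)) (c * f)"
          using wless_mult[OF f Suc.prems(1)] by (simp add: ac_simps)
        have hN: "wless W (Suc (N + w)) h" using hn N by (auto intro: wless_mono)
        have "wpart W (N + w) (h - c * f) \<in> idl.span T"
          by (rule degenerates_top[OF D Suc.prems(2)]) (intro wless_diff hN cf)
        also have "wpart W (N + w) (h - c * f) = - (?g * wpart W N c)"
          using wpart_wless[OF hn N] by (simp add: wpart_diff wpart_mult_top[OF Suc.prems(1) f])
        finally have "?g * wpart W N c \<in> idl.span T" using idl.span_neg by fastforce
        then have "wpart W N c \<in> idl.span T" using g by (simp add: nzd_mod_def)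
        then obtain b where b: "b \<in> idl.span S" "wless W N (c - b)"
          using degenerates_reduce[OF D Suc.prems(1)] by metis
        have "h - (c - b) * f = (h - c * f) + f * b" by (simp add: algebra_simps)
        also have "\<dots> \<in> idl.span S" using Suc.prems(2) b by (intro idl.span_add idl.span_scale)
        finally show ?thesis using Suc.IH b by blast
      qed
    qed
    obtain c where "h - c * f \<in> idl.span S" using h by (auto simp: idl.span_insert)
    then obtain c where c: "h - c * f \<in> idl.span S" "wless W (Suc n - w) c"
      using lower wless_exists by metis
    show "wpart W n h \<in> idl.span (insert ?g T)"
    proof (cases "w \<le> n")
      case True
      then have cn: "wless W (Suc (n - w)) c" using c by (simp add: Suc_diff_le)
      have "wless W (Suc n) (c * f)"
        using wless_mult[OF f cn] True by (simp add: ac_simps)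
      then have "wpart W n (h - c * f) \<in> idl.span T"
        using degenerates_top[OF D c(1)] hn wless_diff by blast
      moreover have "wpart W n (c * f) = wpart W (n - w) c * ?g"
        using wpart_mult_top[OF cn f] True by simp
      moreover have "wpart W n h = wpart W n (h - c * f) + wpart W n (c * f)"
        by (simp add: wpart_diff)
      ultimately show ?thesis using mono base by (auto intro: idl.span_add)
    next
      case False
      then have "c = 0" using c(2) by (simp add: wless_zero_iff Suc_diff_le)
      then show ?thesis using degenerates_top[OF D _ hn] c(1) mono by auto
    qed
  }
  {
    fix q n assume "q \<in> idl.span (insert ?g T)"
    then obtain c where c: "q - c * ?g \<in> idl.span T" by (auto simp: idl.span_insert)
    define c' where "c' = (if w \<le> n then wpart W (n - w) c else 0)"
    have q: "wpart W n q = wpart W n (q - c * ?g) + c' * ?g"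
      by (simp add: wpart_diff wpart_mult_homog[OF homog_wpart] c'_def)
    have j: "wpart W n (q - c * ?g) \<in> idl.span T" using c D by (auto simp: degenerates_def)
    then show "wpart W n q \<in> idl.span (insert ?g T)"
      unfolding q using mono base by (auto intro: idl.span_add)
    obtain h where h: "h \<in> idl.span S" "wless W (Suc n) h" "wpart W n h = wpart W n (q - c * ?g)"
      using c D unfolding degenerates_def by blast
    have c'f: "wless W (Suc n) (c' * f) \<and> wpart W n (c' * f) = c' * ?g"
    proof (cases "w \<le> n")
      case True
      have *: "wless W (Suc (n - w)) c'"
        unfolding c'_def using True by (auto intro: homog_imp_wless homog_wpart)
      show ?thesis
        using wless_mult[OF * f] wpart_mult_top[OF * f] True
        by (simp add: c'_def wpart_homog[OF homog_wpart])
    qed (simp add: c'_def)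
    show "\<exists>h\<in>idl.span (insert f S). wless W (Suc n) h \<and> wpart W n h = wpart W n q"
    proof (rule bexI)
      show "wless W (Suc n) (h + c' * f) \<and> wpart W n (h + c' * f) = wpart W n q"
        using h c'f q by (simp add: wless_add wpart_add)
      show "h + c' * f \<in> idl.span (insert f S)"
        using h mono base by (auto intro: idl.span_add)
    qed
  }
qed

text \<open>Regular in every order: the family and each of its subfamilies, arbitrarily enumerated, is a regular
sequence up to properness of the ideal.\<close>

definition regular_family :: "('b \<Rightarrow> 'a::comm_ring_1) \<Rightarrow> 'b set \<Rightarrow> bool" where
  "regular_family f B \<longleftrightarrow> (\<forall>b\<in>B. \<forall>A\<subseteq>B - {b}. nzd_mod (idl.span (f ` A)) (f b))"

lemma degenerates_family:
  assumes "finite B" and "\<And>b. b \<in> B \<Longrightarrow> wless W (Suc (w b)) (f b)"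
    and "\<And>b. b \<in> B \<Longrightarrow> wpart W (w b) (f b) = g b" and "regular_family g B"
  shows "degenerates W (idl.span (f ` B)) (idl.span (g ` B))"
  using assms
proof (induction B)
  case empty
  show ?case by (auto simp: degenerates_def)
next
  case (insert b B)
  have "regular_family g B" using insert.prems(3) unfolding regular_family_def by blast
  then have D: "degenerates W (idl.span (f ` B)) (idl.span (g ` B))" using insert by simp
  have "nzd_mod (idl.span (g ` B)) (g b)"
    using insert.prems(3) insert.hyps unfolding regular_family_def by blast
  then show ?case using degenerates_insert[OF D, of "w b" "f b"] insert.prems by simp
qed

text \<open>Regularity of the initial forms carries over to the polynomials, by applying \<open>degenerates_family\<close>
and \<open>degenerates_nzd_mod\<close> to each subfamily.\<close>

lemma regular_family_lift:
  assumes B: "finite B" and f: "\<And>b. b \<in> B \<Longrightarrow> wless W (Suc (w b)) (f b)"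
    and g: "\<And>b. b \<in> B \<Longrightarrow> wpart W (w b) (f b) = g b" and reg: "regular_family g B"
  shows "regular_family f B"
  unfolding regular_family_def
proof (intro ballI allI impI)
  fix b A assume b: "b \<in> B" and A: "A \<subseteq> B - {b}"
  have "regular_family g A" using reg A unfolding regular_family_def by blast
  then have "degenerates W (idl.span (f ` A)) (idl.span (g ` A))"
    using A B by (intro degenerates_family[where w = w] f g) (auto intro: finite_subset)
  moreover have "nzd_mod (idl.span (g ` A)) (wpart W (w b) (f b))"
    using reg A b g unfolding regular_family_def by simp
  ultimately show "nzd_mod (idl.span (f ` A)) (f b)" by (rule degenerates_nzd_mod[OF _ f[OF b]])
qed

section \<open>Monomial ideals\<close>

abbreviation monom_poly :: "('x \<Rightarrow>\<^sub>0 nat) \<Rightarrow> ('x, 'k::comm_ring_1) mpoly" where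
  "monom_poly m \<equiv> Poly_Mapping.single m 1"

lemma poly_mapping_sum_single: "(p :: _ \<Rightarrow>\<^sub>0 _::comm_monoid_add) = (\<Sum>m\<in>keys p. Poly_Mapping.single m (lookup p m))"
  by (rule poly_mapping_eqI) (auto simp: lookup_sum lookup_single when_def in_keys_iff)

lemma keys_add_nat: "keys (a + b :: 'x \<Rightarrow>\<^sub>0 nat) = keys a \<union> keys b"
  by (auto simp: in_keys_iff lookup_add)

lemma monomial_dvd_iff: "(\<exists>s. m = t + s) \<longleftrightarrow> (\<forall>x. lookup t x \<le> lookup (m :: 'x \<Rightarrow>\<^sub>0 nat) x)"
proof
  assume "\<forall>x. lookup t x \<le> lookup m x"
  then have "m = t + (m - t)" by (intro poly_mapping_eqI) (simp add: lookup_add lookup_minus)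
  then show "\<exists>s. m = t + s" by blast
qed (auto simp: lookup_add)

lemma monomial_ideal_iff:
  "(p :: ('x, 'k::comm_ring_1) mpoly) \<in> idl.span (monom_poly ` T) \<longleftrightarrow>
     (\<forall>m\<in>keys p. \<exists>t\<in>T. \<forall>x. lookup t x \<le> lookup m x)"
proof
  assume "p \<in> idl.span (monom_poly ` T)"
  then show "\<forall>m\<in>keys p. \<exists>t\<in>T. \<forall>x. lookup t x \<le> lookup m x"
  proof (induction rule: idl.span_induct_alt)
    case (step c q r)
    then obtain t where t: "t \<in> T" "q = monom_poly t" by blast
    have "\<exists>t\<in>T. \<forall>x. lookup t x \<le> lookup m x" if "m \<in> keys (c * q)" for m
      using that
    proof (rule keys_multE)
      fix a b assume "m = a + b" "a \<in> keys c" "b \<in> keys q"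
      then have "m = a + t" using t by (auto split: if_splits)
      then show ?thesis using t by (auto simp: lookup_add intro!: bexI[of _ t])
    qed
    then show ?case using step.IH Poly_Mapping.keys_add[of "c * q" r] by blast
  qed simp
next
  assume *: "\<forall>m\<in>keys p. \<exists>t\<in>T. \<forall>x. lookup t x \<le> lookup m x"
  have "Poly_Mapping.single m c \<in> idl.span (monom_poly ` T)" if m: "m \<in> keys p" for m and c :: 'k
  proof -
    obtain t s where "t \<in> T" "m = t + s" using * m monomial_dvd_iff by metis
    then have "Poly_Mapping.single m c = Poly_Mapping.single s c * monom_poly t"
      by (simp add: mult_single add.commute)
    then show ?thesis using \<open>t \<in> T\<close> by (auto intro: idl.span_scale idl.span_base)
  qed
  then show "p \<in> idl.span (monom_poly ` T)"
    by (subst poly_mapping_sum_single) (rule idl.span_sum)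
qed

lemma lookup_monom_mult:
  "lookup (monom_poly u * a :: ('x, 'k::comm_ring_1) mpoly) (u + m) = lookup a m"
proof -
  have "monom_poly u * a = (\<Sum>n\<in>keys a. Poly_Mapping.single (u + n) (lookup a n))"
    by (subst poly_mapping_sum_single[of a]) (simp add: sum_distrib_left mult_single)
  then show ?thesis by (simp add: lookup_sum lookup_single when_def in_keys_iff)
qed

text \<open>A generator that divides \<open>u + m\<close> and shares no variable with \<open>u\<close> already divides \<open>m\<close>.\<close>

lemma nzd_mod_coprime_monomial:
  assumes "\<And>t. t \<in> T \<Longrightarrow> keys t \<inter> keys u = {}"
  shows "nzd_mod (idl.span (monom_poly ` T)) (monom_poly u :: ('x, 'k::comm_ring_1) mpoly)"
  unfolding nzd_mod_def monomial_ideal_iff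
proof (intro allI impI ballI)
  fix a :: "('x, 'k) mpoly" and m
  assume *: "\<forall>m\<in>keys (monom_poly u * a). \<exists>t\<in>T. \<forall>x. lookup t x \<le> lookup m x" and "m \<in> keys a"
  then have "u + m \<in> keys (monom_poly u * a)" by (simp add: in_keys_iff lookup_monom_mult)
  then obtain t where t: "t \<in> T" "\<And>x. lookup t x \<le> lookup (u + m) x" using * by blast
  have "lookup t x \<le> lookup m x" for x
  proof (cases "x \<in> keys t")
    case True
    then have "lookup u x = 0" using assms[OF t(1)] by (auto simp: in_keys_iff)
    then show ?thesis using t(2)[of x] by (simp add: lookup_add)
  qed (simp add: in_keys_iff)
  then show "\<exists>t\<in>T. \<forall>x. lookup t x \<le> lookup m x" using t(1) by blast
qed

text \<open>If no generator divides the monomial \<open>m\<close> of \<open>a\<close>, then, the generators being squarefree, each of them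
involves a variable outside \<open>m\<close>.  Setting those variables to zero kills the ideal but not \<open>a\<close>, and
hence no power of \<open>a\<close>, since polynomial rings over a field are integral domains.  The linear order on the
variables is there for this last fact, which is proved by comparing leading monomials.\<close>

lemma radical_mod_squarefree:
  fixes T :: "('x::linorder \<Rightarrow>\<^sub>0 nat) set"
  assumes sqf: "\<And>t x. t \<in> T \<Longrightarrow> lookup t x \<le> 1"
  shows "radical_mod (idl.span (monom_poly ` T :: ('x, 'k::field) mpoly set))"
  unfolding radical_mod_def
proof (intro allI impI, rule ccontr)
  let ?J = "idl.span (monom_poly ` T :: ('x, 'k) mpoly set)"
  fix a k assume ak: "a ^ k \<in> ?J" and "a \<notin> ?J"
  then obtain m where m: "m \<in> keys a" "\<And>t. t \<in> T \<Longrightarrow> \<not> (\<forall>x. lookup t x \<le> lookup m x)"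
    unfolding monomial_ideal_iff by blast
  \<comment> \<open>set all variables outside \<open>m\<close> to zero\<close>
  define P where "P m' \<longleftrightarrow> keys m' \<subseteq> keys m" for m' :: "'x \<Rightarrow>\<^sub>0 nat"
  have notP: "\<not> P n" if "\<forall>x. lookup t x \<le> lookup n x" "t \<in> T" for n t
  proof
    assume "P n"
    have "lookup t x \<le> lookup m x" for x
    proof (cases "x \<in> keys t")
      case True
      then have "lookup n x \<noteq> 0" using that(1) by (metis in_keys_iff le_zero_eq)
      then have "lookup m x \<noteq> 0" using \<open>P n\<close> unfolding P_def by (metis in_keys_iff subsetD)
      then show ?thesis using sqf[OF that(2), of x] by simp
    qed (simp add: in_keys_iff)
    then show False using m(2) that(2) by blast
  qed
  have "restr P (a ^ j) = restr P a ^ j" for j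
  proof (induction j)
    case 0
    have "restr P (1 :: ('x, 'k) mpoly) = 1" by (rule restr_eq_self) (simp add: P_def)
    then show ?case by simp
  next
    case (Suc j)
    then show ?case by (simp add: restr_mult_hom P_def keys_add_nat)
  qed
  moreover have "restr P (a ^ k) = 0"
    using ak notP unfolding monomial_ideal_iff by (intro restr_eq_zero) blast
  ultimately have "restr P a = 0" by (metis power_not_zero)
  moreover have "m \<in> keys (restr P a)" using m(1) by (simp add: keys_restr P_def)
  ultimately show False by simp
qed

section \<open>Substitution of polynomials for variables\<close>

definition eval_monom :: "('x \<Rightarrow> 'a) \<Rightarrow> ('x \<Rightarrow>\<^sub>0 nat) \<Rightarrow> 'a::comm_ring_1" where
  "eval_monom \<sigma> m = (\<Prod>x\<in>keys m. \<sigma> x ^ lookup m x)"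

definition subst :: "('x \<Rightarrow> ('x, 'k) mpoly) \<Rightarrow> ('x, 'k::field) mpoly \<Rightarrow> ('x, 'k) mpoly" where
  "subst \<sigma> p = (\<Sum>m\<in>keys p. Poly_Mapping.single 0 (lookup p m) * eval_monom \<sigma> m)"

lemma eval_monom_superset:
  assumes "finite A" "keys m \<subseteq> A"
  shows "eval_monom \<sigma> m = (\<Prod>x\<in>A. \<sigma> x ^ lookup m x)"
  unfolding eval_monom_def by (rule prod.mono_neutral_left) (use assms in \<open>auto simp: in_keys_iff\<close>)

lemma eval_monom_add: "eval_monom \<sigma> (a + b) = eval_monom \<sigma> a * eval_monom \<sigma> b"
proof -
  let ?A = "keys a \<union> keys b"
  have "keys (a + b) \<subseteq> ?A" by (rule Poly_Mapping.keys_add)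
  then show ?thesis
    by (simp add: eval_monom_superset[of ?A] lookup_add power_add prod.distrib)
qed

lemma subst_superset:
  assumes "finite A" "keys p \<subseteq> A"
  shows "subst \<sigma> p = (\<Sum>m\<in>A. Poly_Mapping.single 0 (lookup p m) * eval_monom \<sigma> m)"
  unfolding subst_def by (rule sum.mono_neutral_left) (use assms in \<open>auto simp: in_keys_iff\<close>)

lemma subst_single: "subst \<sigma> (Poly_Mapping.single m c) = Poly_Mapping.single 0 c * eval_monom \<sigma> m"
  by (simp add: subst_superset[of "{m}"])

lemma subst_zero [simp]: "subst \<sigma> 0 = 0"
  by (simp add: subst_def)

lemma subst_add: "subst \<sigma> (p + q) = subst \<sigma> p + subst \<sigma> q"
proof -
  let ?A = "keys p \<union> keys q"
  have "keys (p + q) \<subseteq> ?A" by (rule Poly_Mapping.keys_add)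
  then show ?thesis
    by (simp add: subst_superset[of ?A] lookup_add single_add distrib_right sum.distrib)
qed

lemma subst_sum: "subst \<sigma> (\<Sum>x\<in>A. f x) = (\<Sum>x\<in>A. subst \<sigma> (f x))"
  by (induction A rule: infinite_finite_induct) (simp_all add: subst_add)

lemma subst_mult: "subst \<sigma> (p * q) = subst \<sigma> p * subst \<sigma> q"
proof -
  let ?s = "\<lambda>p m. Poly_Mapping.single m (lookup p m)"
  have single: "subst \<sigma> (Poly_Mapping.single m c * Poly_Mapping.single n d)
      = subst \<sigma> (Poly_Mapping.single m c) * subst \<sigma> (Poly_Mapping.single n d)" for m n c d
  proof -
    have *: "Poly_Mapping.single 0 (c * d) = Poly_Mapping.single 0 c * Poly_Mapping.single (0 :: 'a \<Rightarrow>\<^sub>0 nat) d"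
      by (simp add: mult_single)
    show ?thesis
      by (simp only: mult_single[of m c n d] subst_single eval_monom_add *) (simp only: ac_simps)
  qed
  have "p * q = (\<Sum>m\<in>keys p. ?s p m) * (\<Sum>n\<in>keys q. ?s q n)"
    by (simp flip: poly_mapping_sum_single)
  then have "p * q = (\<Sum>m\<in>keys p. \<Sum>n\<in>keys q. ?s p m * ?s q n)"
    by (simp only: sum_product)
  then have "subst \<sigma> (p * q) = (\<Sum>m\<in>keys p. \<Sum>n\<in>keys q. subst \<sigma> (?s p m) * subst \<sigma> (?s q n))"
    by (simp only: subst_sum single)
  also have "\<dots> = subst \<sigma> (\<Sum>m\<in>keys p. ?s p m) * subst \<sigma> (\<Sum>m\<in>keys q. ?s q m)"
    by (simp only: subst_sum sum_product)
  finally show ?thesis by (simp flip: poly_mapping_sum_single)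
qed

lemma subst_one [simp]: "subst \<sigma> 1 = 1"
  using subst_single[of \<sigma> 0 1] by (simp add: eval_monom_def)

lemma subst_prod: "subst \<sigma> (\<Prod>x\<in>A. f x) = (\<Prod>x\<in>A. subst \<sigma> (f x))"
  by (induction A rule: infinite_finite_induct) (simp_all add: subst_mult)

lemma subst_pvar [simp]: "subst \<sigma> (pvar x) = \<sigma> x"
  by (simp add: pvar_def subst_single eval_monom_def)

lemma subst_span:
  assumes p: "p \<in> idl.span S" and S: "\<And>q. q \<in> S \<Longrightarrow> subst \<sigma> q \<in> idl.span T"
  shows "subst \<sigma> p \<in> idl.span T"
  using p
proof (induction rule: idl.span_induct_alt)
  case (step c q r)
  then show ?case
    by (simp add: subst_add subst_mult S idl.span_add idl.span_scale)
qed (simp add: idl.span_zero)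

lemma subst_cong_mod:
  assumes "\<And>x. \<sigma> x - \<tau> x \<in> idl.span S"
  shows "subst \<sigma> p - subst \<tau> p \<in> idl.span S"
proof -
  have "eval_monom \<sigma> m - eval_monom \<tau> m \<in> idl.span S" for m
    unfolding eval_monom_def by (intro cong_prod_mod cong_power_mod assms)
  then have "(\<Sum>m\<in>keys p. Poly_Mapping.single 0 (lookup p m) * (eval_monom \<sigma> m - eval_monom \<tau> m))
      \<in> idl.span S"
    by (intro idl.span_sum idl.span_scale)
  then show ?thesis by (simp add: subst_def right_diff_distrib sum_subtractf)
qed

lemma prod_pvar_power:
  "(\<Prod>x\<in>A. pvar x ^ k x) = (monom_poly (\<Sum>x\<in>A. Poly_Mapping.single x (k x)) :: ('x, 'k::field) mpoly)"
proof -
  have *: "pvar x ^ n = (monom_poly (Poly_Mapping.single x n) :: ('x, 'k) mpoly)" for x n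
    by (induction n) (simp_all add: pvar_def mult_single single_add[symmetric] add.commute)
  show ?thesis
    by (induction A rule: infinite_finite_induct) (simp_all add: * mult_single)
qed

text \<open>Multiplying each variable by the power of \<open>D\<close> given by its weight; on homogeneous polynomials this clears
denominators, see \<open>prime_mod_attach_vertex\<close>.\<close>

lemma subst_scaled_pvar:
  assumes "homog W k p"
  shows "subst (\<lambda>x. D ^ W x * pvar x) p = D ^ k * p"
proof -
  have "(\<Prod>x\<in>keys m. pvar x ^ lookup m x) = (monom_poly m :: ('a, 'b) mpoly)" for m
    using prod_pvar_power[of "lookup m" "keys m"] by (simp flip: poly_mapping_sum_single)
  then have *: "eval_monom (\<lambda>x. D ^ W x * pvar x) m = D ^ wt W m * monom_poly m" for m
    by (simp add: eval_monom_def wt_def power_mult_distrib prod.distrib power_sum power_mult)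
  have "Poly_Mapping.single 0 (lookup p m) * eval_monom (\<lambda>x. D ^ W x * pvar x) m
      = D ^ k * Poly_Mapping.single m (lookup p m)" if "m \<in> keys p" for m
  proof -
    have "Poly_Mapping.single 0 (lookup p m) * eval_monom (\<lambda>x. D ^ W x * pvar x) m
        = D ^ k * (Poly_Mapping.single 0 (lookup p m) * monom_poly m)"
      using assms that unfolding * by (simp only: homog_def mult.left_commute)
    then show ?thesis by (simp add: mult_single)
  qed
  then have "subst (\<lambda>x. D ^ W x * pvar x) p
      = (\<Sum>m\<in>keys p. D ^ k * Poly_Mapping.single m (lookup p m))"
    unfolding subst_def by (intro sum.cong) auto
  then show ?thesis by (simp flip: sum_distrib_left poly_mapping_sum_single)
qed

lemma homog_subst:
  assumes \<sigma>: "\<And>x. homog W (W x) (\<sigma> x)" and p: "homog W k p"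
  shows "homog W k (subst \<sigma> p)"
  unfolding subst_def
proof (rule homog_sum)
  fix m assume "m \<in> keys p"
  then have m: "wt W m = k" using p by (simp add: homog_def)
  have "homog W (wt W m) (eval_monom \<sigma> m)"
    unfolding eval_monom_def wt_def by (intro homog_prod homog_power \<sigma>)
  moreover have "homog W 0 (Poly_Mapping.single 0 (lookup p m) :: ('a, 'b) mpoly)"
    by (simp add: homog_def)
  ultimately show "homog W k (Poly_Mapping.single 0 (lookup p m) * eval_monom \<sigma> m)"
    using homog_mult m by fastforce
qed

lemma wpart_subst:
  assumes \<sigma>: "\<And>x. homog W (W x) (\<sigma> x)"
  shows "wpart W k (subst \<sigma> p) = subst \<sigma> (wpart W k p)"
proof -
  obtain N where N: "wless W N p" using wless_exists by blast
  have "wpart W k (subst \<sigma> p) = (\<Sum>j<N. wpart W k (subst \<sigma> (wpart W j p)))"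
    by (subst sum_wpart[OF N]) (simp add: subst_sum wpart_sum)
  also have "\<dots> = (\<Sum>j<N. if j = k then subst \<sigma> (wpart W k p) else 0)"
    by (rule sum.cong) (auto simp: wpart_homog[OF homog_subst[OF \<sigma> homog_wpart]])
  also have "\<dots> = subst \<sigma> (wpart W k p)"
    by (auto simp: wpart_wless[OF N])
  finally show ?thesis .
qed

section \<open>Edge polynomials with prescribed levels\<close>

text \<open>The Lovasz--Saks--Schrijver polynomial of \<open>e\<close> with its sum restricted to the layers in \<open>L\<close>.  Every
initial form in the proof has this shape: one layer gives a monomial, two layers a binomial.\<close>

definition level_poly :: "nat set \<Rightarrow> 'v set \<Rightarrow> ('v \<times> nat, 'k::field) mpoly" where
  "level_poly L e = (\<Sum>l\<in>L. \<Prod>i\<in>e. pvar (i, l))"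

lemma LSS_poly_eq_level_poly: "LSS_poly d = level_poly {1..d}"
  by (simp add: fun_eq_iff LSS_poly_def level_poly_def)

lemma homog_level: "homog W (\<Sum>i\<in>e. W (i, l)) (\<Prod>i\<in>e. pvar (i, l))"
  by (intro homog_prod homog_pvar)

text \<open>All terms of one layer have the same weight, so passing to the initial form selects the layers of
maximal weight.\<close>

lemma level_poly_top:
  assumes "finite L" "L' \<subseteq> L" and "\<And>l. l \<in> L' \<Longrightarrow> (\<Sum>i\<in>e. W (i, l)) = w"
    and "\<And>l. l \<in> L - L' \<Longrightarrow> (\<Sum>i\<in>e. W (i, l)) < w"
  shows "wless W (Suc w) (level_poly L e)" and "wpart W w (level_poly L e) = level_poly L' e"
proof -
  have le: "(\<Sum>i\<in>e. W (i, l)) \<le> w" if "l \<in> L" for l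
    using assms(3,4) that by (cases "l \<in> L'") (auto intro: less_imp_le)
  show "wless W (Suc w) (level_poly L e)"
    unfolding level_poly_def
    by (intro wless_sum) (use le in \<open>auto intro: wless_mono[OF homog_imp_wless[OF homog_level]]\<close>)
  have "wpart W w (level_poly L e) = (\<Sum>l\<in>L. if l \<in> L' then (\<Prod>i\<in>e. pvar (i, l)) else 0)"
    unfolding level_poly_def wpart_sum
  proof (rule sum.cong)
    fix l assume "l \<in> L"
    then show "wpart W w (\<Prod>i\<in>e. pvar (i, l)) = (if l \<in> L' then (\<Prod>i\<in>e. pvar (i, l)) else 0)"
      using assms(3,4)[of l] by (cases "l \<in> L'") (auto simp: wpart_homog[OF homog_level])
  qed simp
  also have "\<dots> = level_poly L' e"
    using assms(1,2) by (simp add: level_poly_def sum.If_cases Int_absorb1)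
  finally show "wpart W w (level_poly L e) = level_poly L' e" .
qed

definition vmon :: "nat \<Rightarrow> 'v set \<Rightarrow> ('v \<times> nat) \<Rightarrow>\<^sub>0 nat" where
  "vmon l e = (\<Sum>i\<in>e. Poly_Mapping.single (i, l) 1)"

lemma lookup_vmon: "finite e \<Longrightarrow> lookup (vmon l e) (i, k) = (if i \<in> e \<and> k = l then 1 else 0)"
  by (auto simp: vmon_def lookup_sum lookup_single when_def)

lemma keys_vmon: "finite e \<Longrightarrow> keys (vmon l e) = e \<times> {l}"
  by (auto simp: in_keys_iff lookup_vmon split: if_splits)

lemma level_poly_singleton: "level_poly {l} e = monom_poly (vmon l e)"
proof -
  have "level_poly {l} e = (\<Prod>x\<in>(\<lambda>i. (i, l)) ` e. pvar x ^ 1)"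
    by (simp add: level_poly_def prod.reindex inj_on_def)
  also have "\<dots> = monom_poly (vmon l e)"
    unfolding prod_pvar_power by (simp add: vmon_def sum.reindex inj_on_def)
  finally show ?thesis .
qed

definition proper_colouring :: "'v set set \<Rightarrow> ('v set \<Rightarrow> nat) \<Rightarrow> bool" where
  "proper_colouring F c \<longleftrightarrow> (\<forall>e\<in>F. finite e) \<and> (\<forall>e\<in>F. \<forall>e'\<in>F. e \<noteq> e' \<and> c e = c e' \<longrightarrow> e \<inter> e' = {})"

lemma image_level_poly_monomial:
  "(\<lambda>e. level_poly {c e} e) ` A = monom_poly ` ((\<lambda>e. vmon (c e) e) ` A)"
  by (simp add: image_image level_poly_singleton)

text \<open>Edges of different colours use variables of different layers, and edges of equal colour have no vertex
in common: in both cases the monomials are coprime.\<close>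

lemma regular_family_colour_monomials:
  assumes "proper_colouring F c"
  shows "regular_family (\<lambda>e. level_poly {c e} e) F"
  unfolding regular_family_def
proof (intro ballI allI impI)
  fix e A assume *: "e \<in> F" "A \<subseteq> F - {e}"
  have "keys (vmon (c e') e') \<inter> keys (vmon (c e) e) = {}" if e': "e' \<in> A" for e'
  proof -
    have "e' \<noteq> e" "e' \<in> F" "finite e" "finite e'" "c e' = c e \<longrightarrow> e' \<inter> e = {}"
      using assms * e' unfolding proper_colouring_def by blast+
    then show ?thesis by (auto simp: keys_vmon)
  qed
  then show "nzd_mod (idl.span ((\<lambda>e. level_poly {c e} e) ` A)) (level_poly {c e} e)"
    by (subst image_level_poly_monomial, subst level_poly_singleton)
      (rule nzd_mod_coprime_monomial, blast)
qed

lemma nzd_mod_pvar_colour_monomials: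
  assumes "proper_colouring F c" and "\<And>e. e \<in> F \<Longrightarrow> i \<in> e \<Longrightarrow> c e \<noteq> l"
  shows "nzd_mod (idl.span ((\<lambda>e. level_poly {c e} e) ` F)) (pvar (i, l))"
  unfolding image_level_poly_monomial pvar_def
proof (rule nzd_mod_coprime_monomial)
  fix t assume "t \<in> (\<lambda>e. vmon (c e) e) ` F"
  then obtain e where "e \<in> F" "t = vmon (c e) e" by blast
  then show "keys t \<inter> keys (Poly_Mapping.single (i, l) (1::nat)) = {}"
    using assms(1) assms(2)[of e] by (auto simp: proper_colouring_def keys_vmon)
qed

lemma radical_mod_colour_monomials:
  fixes F :: "'v::linorder set set"
  assumes "proper_colouring F c"
  shows "radical_mod (idl.span ((\<lambda>e. level_poly {c e} e :: ('v \<times> nat, 'k::field) mpoly) ` F))"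
  unfolding image_level_poly_monomial
proof (rule radical_mod_squarefree)
  fix t x assume "t \<in> (\<lambda>e. vmon (c e) e) ` F"
  then show "lookup t x \<le> 1"
    using assms by (cases x) (auto simp: proper_colouring_def lookup_vmon)
qed

section \<open>Determinants and Cramer's rule\<close>

lemma homog_signof: "homog W 0 (signof p)"
  by (cases "evenperm p") (simp_all add: sign_def homog_uminus)

lemma homog_det_zero:
  assumes A: "A \<in> carrier_mat n n"
    and "\<And>i j. i < n \<Longrightarrow> j < n \<Longrightarrow> homog W 0 (A $$ (i, j))"
  shows "homog W 0 (det A)"
  unfolding det_def'[OF A]
proof (rule homog_sum)
  fix p assume "p \<in> {p. p permutes {0..<n}}"
  then have "p i < n" if "i < n" for i
    using that by (metis atLeastLessThan_iff mem_Collect_eq permutes_in_image zero_le)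
  then have "homog W (\<Sum>i = 0..<n. 0) (\<Prod>i = 0..<n. A $$ (i, p i))"
    by (intro homog_prod assms) auto
  then show "homog W 0 (signof p * (\<Prod>i = 0..<n. A $$ (i, p i)))"
    using homog_mult[OF homog_signof] by fastforce
qed

lemma homog_adj_mat_zero:
  assumes A: "A \<in> carrier_mat n n"
    and hom: "\<And>i j. i < n \<Longrightarrow> j < n \<Longrightarrow> homog W 0 (A $$ (i, j))" and ij: "i < n" "j < n"
  shows "homog W 0 (adj_mat A $$ (i, j))"
proof -
  have D: "mat_delete A j i \<in> carrier_mat (n - 1) (n - 1)"
    using A by (rule mat_delete_carrier)
  have "homog W 0 (det (mat_delete A j i))"
  proof (rule homog_det_zero[OF D])
    fix i' j' assume "i' < n - 1" "j' < n - 1"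
    then show "homog W 0 (mat_delete A j i $$ (i', j'))"
      using A by (auto simp: mat_delete_def intro!: hom)
  qed
  moreover have "homog W 0 ((-1) ^ (j + i) :: ('a, 'b) mpoly)"
    using homog_power[OF homog_uminus[OF homog_one], of W "j + i"] by simp
  ultimately show ?thesis
    using A ij homog_mult by (fastforce simp: adj_mat_def cofactor_def)
qed

text \<open>By the hypothesis, the weights corrected by the potential \<open>\<zeta>\<close> have in each column a strict maximum on
the diagonal.  Along a permutation the potential cancels, so the identity contributes the unique term
of maximal weight to the Leibniz expansion.\<close>

lemma det_initial_form:
  fixes W :: "'x \<Rightarrow> nat" and \<zeta> :: "nat \<Rightarrow> int"
  assumes pot: "\<And>i j. i < t \<Longrightarrow> j < t \<Longrightarrow> i \<noteq> j \<Longrightarrow> int (W (x i j)) - int (W (x j j)) < \<zeta> i - \<zeta> j"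
  defines "A \<equiv> mat t t (\<lambda>(i, j). pvar (x i j) :: ('x, 'k::field) mpoly)"
  shows "wless W (Suc (\<Sum>i<t. W (x i i))) (det A)"
    and "wpart W (\<Sum>i<t. W (x i i)) (det A) = (\<Prod>i<t. pvar (x i i))"
proof -
  let ?w = "\<Sum>i<t. W (x i i)" and ?S = "{p. p permutes {0..<t}}"
  let ?term = "\<lambda>p. signof p * (\<Prod>i<t. pvar (x i (p i))) :: ('x, 'k) mpoly"
  have range: "p i < t" if "p \<in> ?S" "i < t" for p i
    using that by (metis atLeastLessThan_iff mem_Collect_eq permutes_in_image zero_le)
  have "det A = (\<Sum>p\<in>?S. signof p * (\<Prod>i = 0..<t. A $$ (i, p i)))"
    by (rule det_def') (simp add: A_def)
  also have "\<dots> = (\<Sum>p\<in>?S. ?term p)"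
    by (intro sum.cong arg_cong2[of _ _ _ _ "(*)"] prod.cong)
      (auto simp: A_def dest: range)
  finally have det: "det A = (\<Sum>p\<in>?S. ?term p)" .
  have hom: "homog W (\<Sum>i<t. W (x i (p i))) (?term p)" for p
    using homog_mult[OF homog_signof homog_prod[of "{..<t}" W "\<lambda>i. W (x i (p i))"]] homog_pvar
    by fastforce
  have less: "(\<Sum>i<t. W (x i (p i))) < ?w" if p: "p \<in> ?S" "p \<noteq> id" for p
  proof -
    let ?g = "\<lambda>j. int (W (x j j)) - \<zeta> j"
    obtain i where i: "p i \<noteq> i" using p(2) by fastforce
    then have "i < t" using p(1) by (metis atLeast0LessThan lessThan_iff mem_Collect_eq permutes_not_in)
    \<comment> \<open>compare the entry in row \<open>i\<close> with the diagonal entry of its column \<open>p i\<close>, and sum\<close>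
    have "(\<Sum>i<t. int (W (x i (p i))) - \<zeta> i) < (\<Sum>i<t. ?g (p i))"
    proof (rule sum_strict_mono_ex1)
      show "\<forall>i\<in>{..<t}. int (W (x i (p i))) - \<zeta> i \<le> ?g (p i)"
        using pot range[OF p(1)] by (smt (verit) lessThan_iff)
      show "\<exists>i\<in>{..<t}. int (W (x i (p i))) - \<zeta> i < ?g (p i)"
        using pot[of i "p i"] range[OF p(1)] i \<open>i < t\<close> by (intro bexI[of _ i]) auto
    qed simp
    also have "(\<Sum>i<t. ?g (p i)) = (\<Sum>i<t. ?g i)"
      using sum.permute[of p "{..<t}" ?g] p(1) by (simp add: atLeast0LessThan)
    finally have "int (\<Sum>i<t. W (x i (p i))) < int ?w"
      by (simp add: sum_subtractf)
    then show ?thesis by (simp only: of_nat_less_iff)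
  qed
  have fin: "finite ?S" and id: "id \<in> ?S" by (simp_all add: finite_permutations permutes_id)
  have top: "?term id = (\<Prod>i<t. pvar (x i i))" by simp
  have split: "det A = (\<Prod>i<t. pvar (x i i)) + (\<Sum>p\<in>?S - {id}. ?term p)"
    unfolding det sum.remove[OF fin id] top ..
  have low: "wless W ?w (\<Sum>p\<in>?S - {id}. ?term p)"
  proof (rule wless_sum)
    fix p assume "p \<in> ?S - {id}"
    then show "wless W ?w (?term p)"
      using wless_mono[OF homog_imp_wless[OF hom[of p]], of ?w] less[of p] by (simp add: Suc_le_eq)
  qed
  have main: "homog W ?w (\<Prod>i<t. pvar (x i i) :: ('x, 'k) mpoly)"
    by (intro homog_prod homog_pvar)
  show "wless W (Suc ?w) (det A)"
    unfolding split by (intro wless_add homog_imp_wless main wless_mono[OF low]) simp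
  show "wpart W ?w (det A) = (\<Prod>i<t. pvar (x i i))"
    unfolding split wpart_add wpart_homog[OF main] wpart_wless[OF low order_refl] by simp
qed

lemma adj_mat_sums:
  fixes A :: "'a::comm_ring_1 mat"
  assumes A: "A \<in> carrier_mat n n" and ij: "i < n" "j < n"
  shows "(\<Sum>k<n. A $$ (i, k) * adj_mat A $$ (k, j)) = (if i = j then det A else 0)"
    and "(\<Sum>k<n. adj_mat A $$ (i, k) * A $$ (k, j)) = (if i = j then det A else 0)"
proof -
  note adj = adj_mat[OF A]
  have "(A * adj_mat A) $$ (i, j) = (\<Sum>k<n. A $$ (i, k) * adj_mat A $$ (k, j))"
    using A adj(1) ij by (simp add: scalar_prod_def atLeast0LessThan)
  moreover have "(A * adj_mat A) $$ (i, j) = (if i = j then det A else 0)"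
    unfolding adj(2) using ij by simp
  ultimately show "(\<Sum>k<n. A $$ (i, k) * adj_mat A $$ (k, j)) = (if i = j then det A else 0)"
    by (simp only:)
  have "(adj_mat A * A) $$ (i, j) = (\<Sum>k<n. adj_mat A $$ (i, k) * A $$ (k, j))"
    using A adj(1) ij by (simp add: scalar_prod_def atLeast0LessThan)
  moreover have "(adj_mat A * A) $$ (i, j) = (if i = j then det A else 0)"
    unfolding adj(3) using ij by simp
  ultimately show "(\<Sum>k<n. adj_mat A $$ (i, k) * A $$ (k, j)) = (if i = j then det A else 0)"
    by (simp only:)
qed

text \<open>The generators for the edges \<open>{v, u a}\<close> form the linear system \<open>A y + r = 0\<close>, where \<open>y\<close> collects the
coordinates of \<open>v\<close> in the layers \<open>k b\<close>.  The endomorphism \<open>\<sigma>\<close> replaces \<open>y\<close> by Cramer's solution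
\<open>- adj A * r\<close> and, to avoid denominators, every other coordinate of \<open>v\<close> by its multiple with \<open>det A\<close>.
It kills these generators and so maps the enlarged ideal into the old, prime one.  Conversely, on
polynomials of degree \<open>j\<close> in the coordinates of \<open>v\<close> it agrees with multiplication by \<open>det A ^ j\<close> modulo
the new generators, and \<open>det A\<close> may be cancelled; thus \<open>p\<close> lies in the enlarged ideal whenever its image
lies in the old one.\<close>

lemma prime_mod_attach_vertex:
  fixes F :: "'v set set" and u :: "nat \<Rightarrow> 'v" and k :: "nat \<Rightarrow> nat"
  assumes F: "\<And>e. e \<in> F \<Longrightarrow> v \<notin> e"
    and u: "\<And>a. a < t \<Longrightarrow> u a \<noteq> v"
    and k: "\<And>a. a < t \<Longrightarrow> k a \<in> {1..d}" "inj_on k {..<t}"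
  defines "f \<equiv> (LSS_poly d :: 'v set \<Rightarrow> ('v \<times> nat, 'k::field) mpoly)"
  defines "F' \<equiv> F \<union> (\<lambda>a. {v, u a}) ` {..<t}"
  defines "A \<equiv> mat t t (\<lambda>(a, b). pvar (u a, k b) :: ('v \<times> nat, 'k) mpoly)"
  assumes prime: "prime_mod (idl.span (f ` F))"
    and nzd: "nzd_mod (idl.span (f ` F')) (det A)"
  shows "prime_mod (idl.span (f ` F'))"
proof -
  let ?I = "idl.span (f ` F')" and ?D = "det A"
  \<comment> \<open>the degree in the coordinates of \<open>v\<close>\<close>
  define W :: "'v \<times> nat \<Rightarrow> nat" where "W x = (if fst x = v then 1 else 0)" for x
  define r :: "nat \<Rightarrow> ('v \<times> nat, 'k) mpoly" where
    "r a = (\<Sum>l\<in>{1..d} - k ` {..<t}. pvar (v, l) * pvar (u a, l))" for a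
  define y :: "nat \<Rightarrow> ('v \<times> nat, 'k) mpoly" where "y a = pvar (v, k a)" for a
  define sol where "sol b = - (\<Sum>a<t. adj_mat A $$ (b, a) * r a)" for b
  define \<sigma> where "\<sigma> x = (if fst x = v
      then if snd x \<in> k ` {..<t} then sol (the_inv_into {..<t} k (snd x)) else ?D * pvar x
      else pvar x)" for x
  have A: "A \<in> carrier_mat t t" by (simp add: A_def)
  have Aab: "A $$ (a, b) = pvar (u a, k b)" if "a < t" "b < t" for a b
    using that by (simp add: A_def)
  have \<sigma>_u: "\<sigma> (u a, l) = pvar (u a, l)" if "a < t" for a l
    using u[OF that] by (simp add: \<sigma>_def)
  have \<sigma>_y: "\<sigma> (v, k a) = sol a" if "a < t" for a
    using that k(2) by (simp add: \<sigma>_def the_inv_into_f_f)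
  have \<sigma>_free: "\<sigma> (v, l) = ?D * pvar (v, l)" if "l \<notin> k ` {..<t}" for l
    using that unfolding \<sigma>_def by simp
  have f_edge: "f {v, u a} = r a + (\<Sum>b<t. A $$ (a, b) * y b)" if a: "a < t" for a
  proof -
    have "f {v, u a} = (\<Sum>l\<in>{1..d}. pvar (v, l) * pvar (u a, l))"
      using u[OF a] by (simp add: f_def LSS_poly_def)
    also have "\<dots> = r a + (\<Sum>l\<in>k ` {..<t}. pvar (v, l) * pvar (u a, l))"
      unfolding r_def by (rule sum.subset_diff) (use k(1) in auto)
    also have "(\<Sum>l\<in>k ` {..<t}. pvar (v, l) * pvar (u a, l)) = (\<Sum>b<t. A $$ (a, b) * y b)"
      using a by (simp add: sum.reindex[OF k(2)] Aab y_def mult.commute)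
    finally show ?thesis .
  qed
  have "subst \<sigma> (f {v, u a}) = 0" if a: "a < t" for a
  proof -
    have "(\<Sum>b<t. A $$ (a, b) * sol b) = - (\<Sum>b<t. \<Sum>c<t. A $$ (a, b) * adj_mat A $$ (b, c) * r c)"
      by (simp only: sol_def mult_minus_right sum_negf sum_distrib_left mult.assoc)
    also have "(\<Sum>b<t. \<Sum>c<t. A $$ (a, b) * adj_mat A $$ (b, c) * r c)
        = (\<Sum>c<t. (\<Sum>b<t. A $$ (a, b) * adj_mat A $$ (b, c)) * r c)"
      by (subst sum.swap) (simp only: sum_distrib_right)
    also have "\<dots> = (\<Sum>c<t. if a = c then ?D * r c else 0)"
      by (rule sum.cong) (auto simp: adj_mat_sums(1)[OF A a])
    also have "\<dots> = ?D * r a" using a by simp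
    finally have "(\<Sum>b<t. A $$ (a, b) * sol b) = - (?D * r a)" .
    moreover have "subst \<sigma> (r a) = ?D * r a"
    proof -
      have "subst \<sigma> (r a) = (\<Sum>l\<in>{1..d} - k ` {..<t}. \<sigma> (v, l) * \<sigma> (u a, l))"
        by (simp only: r_def subst_sum subst_mult subst_pvar)
      also have "\<dots> = (\<Sum>l\<in>{1..d} - k ` {..<t}. ?D * (pvar (v, l) * pvar (u a, l)))"
        by (rule sum.cong) (simp_all only: \<sigma>_u[OF a] \<sigma>_free Diff_iff mult.assoc simp_thms)
      finally show ?thesis by (simp only: r_def sum_distrib_left)
    qed
    moreover have "subst \<sigma> (\<Sum>b<t. A $$ (a, b) * y b) = (\<Sum>b<t. A $$ (a, b) * sol b)"
      using a by (simp add: subst_sum subst_mult Aab y_def \<sigma>_u \<sigma>_y)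
    ultimately show ?thesis by (simp add: f_edge[OF a] subst_add)
  qed
  moreover have "subst \<sigma> (f e) = f e" if "e \<in> F" for e
  proof -
    have "\<sigma> (i, l) = pvar (i, l)" if "i \<in> e" for i l
      using F[OF \<open>e \<in> F\<close>] that by (auto simp: \<sigma>_def)
    then show ?thesis by (simp add: f_def LSS_poly_def subst_sum subst_prod)
  qed
  ultimately have subst_gens: "subst \<sigma> q \<in> idl.span (f ` F)" if "q \<in> f ` F'" for q
    using that by (auto simp: F'_def idl.span_zero intro: idl.span_base)
  have cong: "?D ^ W x * pvar x - \<sigma> x \<in> ?I" for x
  proof (cases "fst x = v \<and> snd x \<in> k ` {..<t}")
    case True
    then obtain b where b: "b < t" "x = (v, k b)" by (cases x) auto
    have "(\<Sum>a<t. adj_mat A $$ (b, a) * (\<Sum>c<t. A $$ (a, c) * y c))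
        = (\<Sum>a<t. \<Sum>c<t. adj_mat A $$ (b, a) * A $$ (a, c) * y c)"
      by (simp only: sum_distrib_left mult.assoc)
    also have "\<dots> = (\<Sum>c<t. (\<Sum>a<t. adj_mat A $$ (b, a) * A $$ (a, c)) * y c)"
      by (subst sum.swap) (simp only: sum_distrib_right)
    also have "\<dots> = (\<Sum>c<t. if b = c then ?D * y c else 0)"
      by (rule sum.cong) (auto simp: adj_mat_sums(2)[OF A b(1)])
    also have "\<dots> = ?D * y b" using b(1) by simp
    finally have "?D * y b - sol b = (\<Sum>a<t. adj_mat A $$ (b, a) * (r a + (\<Sum>c<t. A $$ (a, c) * y c)))"
      by (simp add: sol_def distrib_left sum.distrib)
    also have "\<dots> = (\<Sum>a<t. adj_mat A $$ (b, a) * f {v, u a})"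
      by (rule sum.cong) (simp_all add: f_edge)
    also have "\<dots> \<in> ?I"
      by (intro idl.span_sum idl.span_scale idl.span_base) (auto simp: F'_def)
    finally show ?thesis using b by (simp add: W_def \<sigma>_y y_def)
  next
    case False
    then have "?D ^ W x * pvar x = \<sigma> x"
      by (cases "fst x = v") (simp_all only: \<sigma>_def W_def if_True if_False power_one_right power_0 mult_1 simp_thms)
    then show ?thesis by (simp add: idl.span_zero)
  qed
  have hom_A: "homog W 0 (A $$ (a, b))" if "a < t" "b < t" for a b
    using that u[of a] homog_pvar[of W "(u a, k b)"] by (simp add: Aab W_def)
  have hom_D: "homog W 0 ?D" using A hom_A by (rule homog_det_zero)
  have hom_r: "homog W 1 (r a)" if "a < t" for a
    unfolding r_def
  proof (rule homog_sum)
    fix l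
    show "homog W 1 (pvar (v, l) * pvar (u a, l))"
      using homog_mult[OF homog_pvar homog_pvar, of W "(v, l)" "(u a, l)"] u[OF that]
      by (simp add: W_def)
  qed
  have hom_sol: "homog W 1 (sol b)" if "b < t" for b
    unfolding sol_def
    using that homog_mult[OF homog_adj_mat_zero[OF A hom_A] hom_r]
    by (intro homog_uminus homog_sum) fastforce
  have hom_\<sigma>: "homog W (W x) (\<sigma> x)" for x
  proof (cases "fst x = v \<and> snd x \<in> k ` {..<t}")
    case True
    then obtain b where "b < t" "x = (v, k b)" by (cases x) auto
    then show ?thesis using hom_sol by (simp add: \<sigma>_y W_def)
  next
    case False
    then show ?thesis
      using homog_pvar[of W x] homog_mult[OF hom_D homog_pvar[of W x]] by (auto simp: \<sigma>_def)
  qed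
  have hom_F: "homog W 0 (f e)" if "e \<in> F" for e
    unfolding f_def LSS_poly_def
  proof (rule homog_sum)
    fix l
    have "(\<Sum>i\<in>e. W (i, l)) = 0" using F[OF that] by (intro sum.neutral) (auto simp: W_def)
    then show "homog W 0 (\<Prod>i\<in>e. pvar (i, l))" using homog_level[of W l e] by simp
  qed
  have F_F': "idl.span (f ` F) \<subseteq> ?I"
    by (intro idl.span_mono image_mono) (simp add: F'_def)
  have lift: "p \<in> ?I" if p: "subst \<sigma> p \<in> idl.span (f ` F)" for p
  proof -
    have "wpart W j p \<in> ?I" for j
    proof -
      have "subst \<sigma> (wpart W j p) \<in> idl.span (f ` F)"
        unfolding wpart_subst[OF hom_\<sigma>, symmetric]
        using hom_F p by (intro wpart_span_homog) blast+
      moreover have "?D ^ j * wpart W j p - subst \<sigma> (wpart W j p) \<in> ?I"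
        using subst_cong_mod[OF cong] by (simp add: subst_scaled_pvar[OF homog_wpart, symmetric])
      ultimately have "?D ^ j * wpart W j p \<in> ?I"
        using F_F' idl.span_add by fastforce
      then show ?thesis using nzd_mod_power[OF nzd] by (simp add: nzd_mod_def)
    qed
    moreover obtain n where "wless W n p" using wless_exists by blast
    ultimately show ?thesis using sum_wpart idl.span_sum by metis
  qed
  show ?thesis
    unfolding prime_mod_def
  proof (intro allI impI)
    fix p q assume "p * q \<in> ?I"
    then have "subst \<sigma> (p * q) \<in> idl.span (f ` F)" using subst_gens by (rule subst_span)
    then have "subst \<sigma> p \<in> idl.span (f ` F) \<or> subst \<sigma> q \<in> idl.span (f ` F)"
      using prime by (simp add: subst_mult prime_mod_def)
    then show "p \<in> ?I \<or> q \<in> ?I" using lift by blast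
  qed
qed

section \<open>Positive matchings as edge colourings with weights\<close>

text \<open>Integrality of the weights makes induction on the weight possible.  Rounding down a large multiple of \<open>w\<close>
changes each edge sum by at most 2, which preserves the finitely many strict inequalities.\<close>

lemma sum_strict_int_weights:
  fixes w :: "'v \<Rightarrow> real"
  assumes fin: "finite F" and card: "\<And>e. e \<in> F \<Longrightarrow> card e = 2"
  shows "\<exists>w' :: 'v \<Rightarrow> int. \<forall>e\<in>F. ((\<Sum>i\<in>e. w i) > 0 \<longrightarrow> (\<Sum>i\<in>e. w' i) > 0) \<and>
    ((\<Sum>i\<in>e. w i) < 0 \<longrightarrow> (\<Sum>i\<in>e. w' i) < 0)"
proof -
  have "\<forall>\<^sub>F n in sequentially. (\<Sum>i\<in>e. w i) \<noteq> 0 \<longrightarrow> 2 < real n * \<bar>\<Sum>i\<in>e. w i\<bar>" for e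
  proof (cases "(\<Sum>i\<in>e. w i) = 0")
    case False
    then have pos: "0 < \<bar>\<Sum>i\<in>e. w i\<bar>" by simp
    obtain N :: nat where N: "2 / \<bar>\<Sum>i\<in>e. w i\<bar> < real N" using reals_Archimedean2 by blast
    have "2 < real n * \<bar>\<Sum>i\<in>e. w i\<bar>" if "N \<le> n" for n
    proof -
      have "2 / \<bar>\<Sum>i\<in>e. w i\<bar> < real n" using N that by linarith
      then show ?thesis using pos by (simp add: pos_divide_less_eq)
    qed
    then show ?thesis by (auto simp: eventually_sequentially)
  qed simp
  then have "\<forall>\<^sub>F n in sequentially. \<forall>e\<in>F. (\<Sum>i\<in>e. w i) \<noteq> 0 \<longrightarrow> 2 < real n * \<bar>\<Sum>i\<in>e. w i\<bar>"
    using fin by (intro eventually_ball_finite) auto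
  then obtain n where n: "\<And>e. e \<in> F \<Longrightarrow> (\<Sum>i\<in>e. w i) \<noteq> 0 \<Longrightarrow> 2 < real n * \<bar>\<Sum>i\<in>e. w i\<bar>"
    by (auto simp: eventually_sequentially)
  have "((\<Sum>i\<in>e. w i) > 0 \<longrightarrow> (\<Sum>i\<in>e. \<lfloor>real n * w i\<rfloor>) > 0) \<and>
      ((\<Sum>i\<in>e. w i) < 0 \<longrightarrow> (\<Sum>i\<in>e. \<lfloor>real n * w i\<rfloor>) < 0)" if e: "e \<in> F" for e
  proof -
    obtain i j where ij: "e = {i, j}" "i \<noteq> j" using card[OF e] by (auto simp: card_2_iff)
    have fl: "\<lfloor>real n * w x\<rfloor> \<le> real n * w x" "real n * w x - 1 < \<lfloor>real n * w x\<rfloor>" for x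
      by linarith+
    have eq: "real n * (\<Sum>i\<in>e. w i) = real n * w i + real n * w j"
      using ij by (simp add: distrib_left)
    show ?thesis
    proof (intro conjI impI)
      assume pos: "(\<Sum>i\<in>e. w i) > 0"
      then have "2 < real n * w i + real n * w j" using n[OF e] eq by simp
      then have "0 < real_of_int (\<lfloor>real n * w i\<rfloor> + \<lfloor>real n * w j\<rfloor>)"
        using fl[of i] fl[of j] unfolding of_int_add by linarith
      then show "(\<Sum>i\<in>e. \<lfloor>real n * w i\<rfloor>) > 0" using ij by (simp only: of_int_0_less_iff) simp
    next
      assume neg: "(\<Sum>i\<in>e. w i) < 0"
      then have "2 < - (real n * (\<Sum>i\<in>e. w i))" using n[OF e] by simp
      then have "real_of_int (\<lfloor>real n * w i\<rfloor> + \<lfloor>real n * w j\<rfloor>) < 0"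
        using fl[of i] fl[of j] eq unfolding of_int_add by linarith
      then show "(\<Sum>i\<in>e. \<lfloor>real n * w i\<rfloor>) < 0" using ij by (simp only: of_int_less_0_iff) simp
    qed
  qed
  then show ?thesis by (intro exI[of _ "\<lambda>i. \<lfloor>real n * w i\<rfloor>"]) blast
qed

text \<open>A positive matching decomposition, with \<open>c e\<close> the index of the part that contains \<open>e\<close>.  The bound \<open>K\<close>
exceeds the absolute value of all edge sums and differences of weights by at least 2; it is the base of the
scaling factors of the layers.\<close>

locale positive_edge_colouring =
  fixes V :: "'v::linorder set" and E :: "'v set set" and p :: nat
    and c :: "'v set \<Rightarrow> nat" and w :: "nat \<Rightarrow> 'v \<Rightarrow> int" and K :: int
  assumes graph: "simple_graph V E"
    and colour_range: "e \<in> E \<Longrightarrow> c e \<in> {1..p}"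
    and proper: "e \<in> E \<Longrightarrow> e' \<in> E \<Longrightarrow> e \<noteq> e' \<Longrightarrow> c e = c e' \<Longrightarrow> e \<inter> e' = {}"
    and pos: "e \<in> E \<Longrightarrow> 0 < (\<Sum>i\<in>e. w (c e) i)"
    and neg: "e \<in> E \<Longrightarrow> 1 \<le> l \<Longrightarrow> l < c e \<Longrightarrow> (\<Sum>i\<in>e. w l i) < 0"
    and K: "2 \<le> K" "l \<in> {1..p} \<Longrightarrow> i \<in> V \<Longrightarrow> 2 * \<bar>w l i\<bar> + 2 \<le> K"

lemma positive_edge_colouring_exists:
  fixes V :: "'v::linorder set"
  assumes graph: "simple_graph V E"
  shows "\<exists>c w K. positive_edge_colouring V E (pmd E) c w K"
proof -
  let ?p = "pmd E"
  have "\<exists>P. positive_matching_decomposition E ?p P"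
    unfolding pmd_def using positive_matching_decomposition_exists[OF graph] by (rule LeastI_ex)
  then obtain P where disj: "disjoint_family_on P {1..?p}" and cover: "E = (\<Union>i\<in>{1..?p}. P i)"
    and match: "\<And>i. i \<in> {1..?p} \<Longrightarrow> positive_matching (E - (\<Union>j\<in>{1..<i}. P j)) (P i)"
    unfolding positive_matching_decomposition_def by blast
  have finV: "finite V" using graph by (simp add: simple_graph_def)
  have "E \<subseteq> Pow V" using graph by (auto simp: simple_graph_def)
  then have finE: "finite E" using finV by (meson finite_Pow_iff finite_subset)
  have card: "card e = 2" if "e \<in> E" for e
    using graph that unfolding simple_graph_def card_2_iff by blast
  have "\<forall>e\<in>E. \<exists>i\<in>{1..?p}. e \<in> P i" using cover by blast
  then obtain c where c: "\<And>e. e \<in> E \<Longrightarrow> c e \<in> {1..?p}" "\<And>e. e \<in> E \<Longrightarrow> e \<in> P (c e)"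
    by metis
  have "\<forall>l. \<exists>w :: 'v \<Rightarrow> int. l \<in> {1..?p} \<longrightarrow> (\<forall>e\<in>P l. (\<Sum>i\<in>e. w i) > 0) \<and>
      (\<forall>e\<in>E - (\<Union>j\<in>{1..<l}. P j) - P l. (\<Sum>i\<in>e. w i) < 0)"
  proof
    fix l
    show "\<exists>w :: 'v \<Rightarrow> int. l \<in> {1..?p} \<longrightarrow> (\<forall>e\<in>P l. (\<Sum>i\<in>e. w i) > 0) \<and>
      (\<forall>e\<in>E - (\<Union>j\<in>{1..<l}. P j) - P l. (\<Sum>i\<in>e. w i) < 0)"
    proof (cases "l \<in> {1..?p}")
      case True
      then obtain w :: "'v \<Rightarrow> real" where w: "\<forall>e\<in>P l. (\<Sum>i\<in>e. w i) > 0"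
        "\<forall>e\<in>E - (\<Union>j\<in>{1..<l}. P j) - P l. (\<Sum>i\<in>e. w i) < 0" and sub: "P l \<subseteq> E"
        using match[OF True] unfolding positive_matching_def by blast
      obtain w' :: "'v \<Rightarrow> int" where "\<forall>e\<in>E. ((\<Sum>i\<in>e. w i) > 0 \<longrightarrow> (\<Sum>i\<in>e. w' i) > 0) \<and>
          ((\<Sum>i\<in>e. w i) < 0 \<longrightarrow> (\<Sum>i\<in>e. w' i) < 0)"
        using sum_strict_int_weights[OF finE card] by blast
      then show ?thesis using w sub by (intro exI[of _ w']) blast
    next
      case False
      then show ?thesis by blast
    qed
  qed
  then obtain w :: "nat \<Rightarrow> 'v \<Rightarrow> int" where w: "\<And>l e. l \<in> {1..?p} \<Longrightarrow> e \<in> P l \<Longrightarrow> (\<Sum>i\<in>e. w l i) > 0"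
    "\<And>l e. l \<in> {1..?p} \<Longrightarrow> e \<in> E - (\<Union>j\<in>{1..<l}. P j) - P l \<Longrightarrow> (\<Sum>i\<in>e. w l i) < 0"
    by metis
  define K where "K = 2 + (\<Sum>l\<in>{1..?p}. \<Sum>i\<in>V. 2 * \<bar>w l i\<bar>)"
  have "positive_edge_colouring V E ?p c w K"
  proof
    show "simple_graph V E" by (rule graph)
    show "c e \<in> {1..?p}" if "e \<in> E" for e using c(1) that .
    show "e \<inter> e' = {}" if e: "e \<in> E" "e' \<in> E" "e \<noteq> e'" "c e = c e'" for e e'
    proof -
      have "disjoint (P (c e))" using match[OF c(1)[OF e(1)]] by (simp add: positive_matching_def)
      then show ?thesis using e c(2)[of e] c(2)[of e'] unfolding disjoint_def by simp
    qed
    show "0 < (\<Sum>i\<in>e. w (c e) i)" if "e \<in> E" for e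
      using w(1) c that by blast
    show "(\<Sum>i\<in>e. w l i) < 0" if e: "e \<in> E" "1 \<le> l" "l < c e" for e l
    proof -
      have "e \<notin> P j" if j: "j \<in> {1..l}" for j
      proof -
        have "P j \<inter> P (c e) = {}"
          using j e c(1)[OF e(1)] by (intro disjoint_family_onD[OF disj]) auto
        then show ?thesis using c(2)[OF e(1)] by blast
      qed
      then show ?thesis using e c(1)[OF e(1)] by (intro w(2)) auto
    qed
    show "2 \<le> K" unfolding K_def by (simp add: sum_nonneg)
    show "2 * \<bar>w l i\<bar> + 2 \<le> K" if "l \<in> {1..?p}" "i \<in> V" for l i
    proof -
      have "2 * \<bar>w l i\<bar> \<le> (\<Sum>i\<in>V. 2 * \<bar>w l i\<bar>)"
        using that finV by (intro member_le_sum) auto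
      also have "\<dots> \<le> (\<Sum>l\<in>{1..?p}. \<Sum>i\<in>V. 2 * \<bar>w l i\<bar>)"
        using that by (intro member_le_sum[where f = "\<lambda>l. \<Sum>i\<in>V. 2 * \<bar>w l i\<bar>"] sum_nonneg) auto
      finally show ?thesis by (simp add: K_def)
    qed
  qed
  then show ?thesis by blast
qed

text \<open>Integer weights become natural numbers after a shift by a constant.  The shift is harmless since every
term of an edge polynomial has degree 2, and \<open>det_initial_form\<close> compares single variables.\<close>

lemma nat_weights_exist:
  fixes U :: "'x \<Rightarrow> int"
  assumes "finite A"
  shows "\<exists>(W :: 'x \<Rightarrow> nat) Z. \<forall>x\<in>A. int (W x) = U x + Z"
proof (intro exI ballI)
  fix x assume "x \<in> A"
  then have "\<bar>U x\<bar> \<le> (\<Sum>x\<in>A. \<bar>U x\<bar>)" using assms by (intro member_le_sum) auto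
  then show "int (nat (U x + (\<Sum>x\<in>A. \<bar>U x\<bar>))) = U x + (\<Sum>x\<in>A. \<bar>U x\<bar>)" by simp
qed

context positive_edge_colouring
begin

lemma finite_V: "finite V"
  using graph by (simp add: simple_graph_def)

lemma finite_E: "finite E"
proof -
  have "E \<subseteq> Pow V" using graph by (auto simp: simple_graph_def)
  then show ?thesis using finite_V by (meson finite_Pow_iff finite_subset)
qed

lemma edgeE:
  assumes "e \<in> E"
  obtains i j where "i \<in> V" "j \<in> V" "i \<noteq> j" "e = {i, j}"
  using graph assms unfolding simple_graph_def by blast

lemma proper_colouring_colour: "F \<subseteq> E \<Longrightarrow> proper_colouring F c"
  unfolding proper_colouring_def using proper by (auto elim!: edgeE)

text \<open>The weight of \<open>y\<^sub>i\<^sub>,\<^sub>l\<close>, with layer \<open>l\<close> dominating all layers after it.\<close>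

definition layered :: "nat \<Rightarrow> 'v \<Rightarrow> int" where
  "layered l i = (if l \<in> {1..p} then K ^ (p - l) * w l i else 0)"

lemma K_power_pos: "0 < K ^ n"
  using K(1) by simp

lemma layered_pos:
  assumes e: "e \<in> E"
  shows "K ^ (p - c e) \<le> (\<Sum>i\<in>e. layered (c e) i)"
proof -
  have "(\<Sum>i\<in>e. layered (c e) i) = K ^ (p - c e) * (\<Sum>i\<in>e. w (c e) i)"
    using colour_range[OF e] by (simp add: layered_def sum_distrib_left)
  moreover have "K ^ (p - c e) * 1 \<le> K ^ (p - c e) * (\<Sum>i\<in>e. w (c e) i)"
    using pos[OF e] K_power_pos by (intro mult_left_mono) (auto intro: less_imp_le)
  ultimately show ?thesis by simp
qed

lemma layered_less:
  assumes e: "e \<in> E" and l: "1 \<le> l" "l \<noteq> c e"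
  shows "(\<Sum>i\<in>e. layered l i) < (\<Sum>i\<in>e. layered (c e) i)"
proof -
  have top: "0 < (\<Sum>i\<in>e. layered (c e) i)"
    using layered_pos[OF e] K_power_pos[of "p - c e"] by linarith
  consider "p < l" | "l < c e" "l \<le> p" | "c e < l" "l \<le> p" using l by linarith
  then show ?thesis
  proof cases
    case 1
    then show ?thesis using top by (simp add: layered_def)
  next
    case 2
    then have "(\<Sum>i\<in>e. layered l i) = K ^ (p - l) * (\<Sum>i\<in>e. w l i)"
      using l by (simp add: layered_def sum_distrib_left)
    also have "\<dots> < 0" using neg[OF e] 2 l K_power_pos by (simp add: mult_pos_neg)
    finally show ?thesis using top by linarith
  next
    case 3
    obtain i j where ij: "i \<in> V" "j \<in> V" "i \<noteq> j" "e = {i, j}" using edgeE[OF e] .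
    have "(\<Sum>i\<in>e. layered l i) = K ^ (p - l) * (w l i + w l j)"
      using l 3 ij by (simp add: layered_def distrib_left)
    also have "\<dots> < K ^ (p - l) * K"
      using K(2)[of l i] K(2)[of l j] ij l 3 K_power_pos by (intro mult_strict_left_mono) auto
    also have "\<dots> = K ^ Suc (p - l)" by simp
    also have "\<dots> \<le> K ^ (p - c e)" using K(1) 3 by (intro power_increasing) auto
    finally show ?thesis using layered_pos[OF e] by linarith
  qed
qed

text \<open>The initial form read off from integer weights \<open>U\<close> before the shift by \<open>Z\<close>; the two endpoints contribute
\<open>2 * Z\<close> to the weight.\<close>

lemma LSS_poly_initial:
  fixes U :: "'v \<times> nat \<Rightarrow> int"
  assumes W: "\<forall>x\<in>V \<times> {1..d}. int (W x) = U x + Z" and e: "e \<in> E"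
    and L': "L' \<subseteq> {1..d}" "L' \<noteq> {}"
    and eq: "\<And>l. l \<in> L' \<Longrightarrow> (\<Sum>i\<in>e. U (i, l)) = a"
    and less: "\<And>l. l \<in> {1..d} - L' \<Longrightarrow> (\<Sum>i\<in>e. U (i, l)) < a"
  shows "wless W (Suc (nat (a + 2 * Z))) (LSS_poly d e)"
    and "wpart W (nat (a + 2 * Z)) (LSS_poly d e) = level_poly L' e"
proof -
  obtain i j where ij: "i \<in> V" "j \<in> V" "i \<noteq> j" "e = {i, j}" using edgeE[OF e] .
  have sum: "int (\<Sum>i\<in>e. W (i, l)) = (\<Sum>i\<in>e. U (i, l)) + 2 * Z" if "l \<in> {1..d}" for l
    using W ij that by simp
  have top: "(\<Sum>i\<in>e. W (i, l)) = nat (a + 2 * Z)" if "l \<in> L'" for l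
  proof -
    have "l \<in> {1..d}" using that L'(1) by blast
    then show ?thesis using sum[of l] eq[OF that] by linarith
  qed
  have low: "(\<Sum>i\<in>e. W (i, l)) < nat (a + 2 * Z)" if "l \<in> {1..d} - L'" for l
  proof -
    have "l \<in> {1..d}" using that by blast
    then show ?thesis using sum[of l] less[OF that] by linarith
  qed
  show "wless W (Suc (nat (a + 2 * Z))) (LSS_poly d e)"
    "wpart W (nat (a + 2 * Z)) (LSS_poly d e) = level_poly L' e"
    unfolding LSS_poly_eq_level_poly
    using level_poly_top[of "{1..d}" L' W e "nat (a + 2 * Z)"] top low L'(1) by simp_all
qed

theorem LSS_regular_radical:
  assumes d: "p \<le> d"
  shows "regular_family (LSS_poly d :: 'v set \<Rightarrow> ('v \<times> nat, 'k::field) mpoly) E"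
    and "radical_mod (idl.span ((LSS_poly d :: 'v set \<Rightarrow> ('v \<times> nat, 'k) mpoly) ` E))"
proof -
  obtain W Z where W: "\<forall>x\<in>V \<times> {1..d}. int (W x) = (\<lambda>(i, l). layered l i) x + Z"
    using nat_weights_exist[of "V \<times> {1..d}" "\<lambda>(i, l). layered l i"] finite_V by auto
  let ?w = "\<lambda>e. nat ((\<Sum>i\<in>e. layered (c e) i) + 2 * Z)"
  have init: "wless W (Suc (?w e)) (LSS_poly d e :: ('v \<times> nat, 'k) mpoly)"
    "wpart W (?w e) (LSS_poly d e :: ('v \<times> nat, 'k) mpoly) = level_poly {c e} e" if "e \<in> E" for e
    using LSS_poly_initial[OF W that, of "{c e}" "\<Sum>i\<in>e. layered (c e) i"]
      colour_range[OF that] layered_less[OF that] d by auto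
  have reg: "regular_family (\<lambda>e. level_poly {c e} e :: ('v \<times> nat, 'k) mpoly) E"
    by (intro regular_family_colour_monomials proper_colouring_colour) simp
  show "regular_family (LSS_poly d :: 'v set \<Rightarrow> ('v \<times> nat, 'k) mpoly) E"
    using finite_E init reg by (rule regular_family_lift[where w = ?w])
  have "degenerates W (idl.span ((LSS_poly d :: 'v set \<Rightarrow> ('v \<times> nat, 'k) mpoly) ` E))
      (idl.span ((\<lambda>e. level_poly {c e} e) ` E))"
    using finite_E init reg by (rule degenerates_family[where w = ?w])
  then show "radical_mod (idl.span ((LSS_poly d :: 'v set \<Rightarrow> ('v \<times> nat, 'k) mpoly) ` E))"
    by (rule degenerates_radical_mod) (intro radical_mod_colour_monomials proper_colouring_colour order_refl)
qed

end

section \<open>Primality by attaching one vertex at a time\<close>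

context positive_edge_colouring
begin

text \<open>What remains to be shown for \<open>prime_mod_attach_vertex\<close> is that the minor is a nonzerodivisor.  The
weights \<open>top\<close> extend \<open>layered\<close> to the layer \<open>z\<close> by \<open>\<zeta>\<close> and to the vertex \<open>v\<close> in such a way that the
layers \<open>k a\<close> and \<open>z\<close> tie on the edge \<open>{v, u a}\<close>.  Both that no further layer interferes on this edge and
that the diagonal dominates the determinant come down to one inequality, \<open>potential\<close> below.\<close>

lemma LSS_prime_insert_vertex:
  assumes z: "p < z" "z \<le> d" and U: "U \<subseteq> V" and v: "v \<in> V" "v \<notin> U"
  defines "f \<equiv> (LSS_poly d :: 'v set \<Rightarrow> ('v \<times> nat, 'k::field) mpoly)"
  assumes prime: "prime_mod (idl.span (f ` {e \<in> E. e \<subseteq> U}))"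
  shows "prime_mod (idl.span (f ` {e \<in> E. e \<subseteq> insert v U}))"
proof -
  define N where "N = {i \<in> U. {v, i} \<in> E}"
  have "finite N" using U finite_V unfolding N_def by (auto intro: finite_subset)
  then obtain us where us: "set us = N" "distinct us" by (metis finite_distinct_list)
  define t where "t = length us"
  define u where "u a = us ! a" for a
  define k where "k a = c {v, u a}" for a
  have uN: "u a \<in> N" if "a < t" for a using that us by (auto simp: u_def t_def)
  have N_u: "\<exists>a<t. i = u a" if "i \<in> N" for i
    using that us by (metis in_set_conv_nth t_def u_def)
  have uE: "{v, u a} \<in> E" and uU: "u a \<in> U" and uV: "u a \<in> V" and uv: "u a \<noteq> v" if "a < t" for a
    using uN[OF that] U v by (auto simp: N_def)
  have k_range: "k a \<in> {1..p}" if "a < t" for a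
    unfolding k_def using colour_range[OF uE[OF that]] .
  have u_inj: "u a = u b \<longleftrightarrow> a = b" if "a < t" "b < t" for a b
    using that us by (simp add: u_def t_def nth_eq_iff_index_eq)
  have k_inj: "k a = k b \<longleftrightarrow> a = b" if "a < t" "b < t" for a b
  proof
    assume "k a = k b"
    then have "{v, u a} = {v, u b}"
      using proper[OF uE[OF that(1)] uE[OF that(2)]] by (auto simp: k_def)
    then show "a = b" using u_inj[OF that] uv[OF that(1)] uv[OF that(2)] by (auto simp: doubleton_eq_iff)
  qed simp
  then have k_inj_on: "inj_on k {..<t}" by (auto simp: inj_on_def)

  define F where "F = {e \<in> E. e \<subseteq> U}"
  define F' where "F' = F \<union> (\<lambda>a. {v, u a}) ` {..<t}"
  have F': "{e \<in> E. e \<subseteq> insert v U} = F'"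
  proof (intro equalityI subsetI)
    fix e assume e: "e \<in> {e \<in> E. e \<subseteq> insert v U}"
    show "e \<in> F'"
    proof (cases "v \<in> e")
      case True
      obtain x y where "x \<noteq> y" "e = {x, y}" using e edgeE by blast
      then obtain i where "e = {v, i}" "i \<noteq> v" using True by blast
      then have "i \<in> N" using e by (auto simp: N_def)
      then show ?thesis using N_u \<open>e = {v, i}\<close> by (auto simp: F'_def)
    qed (use e in \<open>auto simp: F'_def F_def\<close>)
  qed (use uE uU in \<open>auto simp: F'_def F_def\<close>)
  have vF: "v \<notin> e" if "e \<in> F" for e using that v by (auto simp: F_def)
  have FE: "F' \<subseteq> E" using F' by blast
  have finF': "finite F'" using FE finite_E by (rule finite_subset)
  have F'_cases: "e \<in> F \<and> v \<notin> e \<or> (\<exists>a<t. e = {v, u a} \<and> c e = k a)" if "e \<in> F'" for e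
    using that vF by (auto simp: F'_def k_def)

  \<comment> \<open>the subtrahend puts layer \<open>z\<close> below the colour on old edges; on new edges only differences enter\<close>
  define \<zeta> where "\<zeta> i = (if i \<in> N then K ^ (p - c {v, i}) else 0) - K ^ p" for i
  have \<zeta>_u: "\<zeta> (u a) = K ^ (p - k a) - K ^ p" if "a < t" for a
    using uN[OF that] by (simp add: \<zeta>_def k_def)
  have \<zeta>_le: "\<zeta> i \<le> 0" for i
    using K(1) K_power_pos[of p] by (auto simp: \<zeta>_def intro!: power_increasing)
  \<comment> \<open>In layer \<open>k a\<close>, a later edge at \<open>v\<close> has negative and the edge to \<open>u a\<close> positive weight, which
    gives a gap of at least \<open>2 * K ^ (p - k a)\<close> and beats the potential difference.  Against an earlier
    edge the potential of \<open>u b\<close> wins, being larger by a factor of at least \<open>K\<close>.\<close>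
  have potential: "layered (k a) (u b) - layered (k a) (u a) < \<zeta> (u b) - \<zeta> (u a)"
    if ab: "a < t" "b < t" "a \<noteq> b" for a b
  proof -
    let ?P = "K ^ (p - k a)" and ?w = "w (k a)"
    note ka = k_range[OF ab(1)] and kb = k_range[OF ab(2)]
    have diff: "layered (k a) (u b) - layered (k a) (u a) = ?P * (?w (u b) - ?w (u a))"
      using ka by (simp add: layered_def right_diff_distrib)
    have "k a \<noteq> k b" using k_inj ab by blast
    then consider "k a < k b" | "k b < k a" by linarith
    then show ?thesis
    proof cases
      case 1
      have "0 < ?w v + ?w (u a)" using pos[OF uE[OF ab(1)]] uv[OF ab(1)] by (simp add: k_def)
      moreover have "?w v + ?w (u b) < 0"
        using neg[OF uE[OF ab(2)], of "k a"] 1 ka uv[OF ab(2)] by (simp add: k_def)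
      ultimately have "?P * (?w (u b) - ?w (u a)) \<le> ?P * (- 2)"
        using K_power_pos by (intro mult_left_mono) (auto intro: less_imp_le)
      then show ?thesis
        using K_power_pos[of "p - k a"] K_power_pos[of "p - k b"] diff \<zeta>_u ab by simp
    next
      case 2
      have "?w (u b) - ?w (u a) \<le> K - 2"
        using K(2)[OF ka uV[OF ab(1)]] K(2)[OF ka uV[OF ab(2)]] by linarith
      then have "?P * (?w (u b) - ?w (u a)) \<le> ?P * (K - 2)"
        using K_power_pos by (intro mult_left_mono) (auto intro: less_imp_le)
      moreover have "K * ?P \<le> K ^ (p - k b)"
      proof -
        have "K ^ Suc (p - k a) \<le> K ^ (p - k b)"
          using K(1) 2 ka by (intro power_increasing) auto
        then show ?thesis by simp
      qed
      moreover have "?P * (K - 2) = K * ?P - 2 * ?P" by (simp add: algebra_simps)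
      ultimately show ?thesis
        using K_power_pos[of "p - k a"] diff \<zeta>_u[OF ab(1)] \<zeta>_u[OF ab(2)] by linarith
    qed
  qed

  \<comment> \<open>a bound that removes the layers of \<open>v\<close> that are neither \<open>z\<close> nor a colour at \<open>v\<close>\<close>
  define Y where "Y = 1 + K ^ p + (\<Sum>x\<in>V \<times> {1..d}. \<bar>layered (snd x) (fst x)\<bar>)"
  have Y: "layered l i - Y < - (K ^ p)" if "i \<in> V" "l \<in> {1..d}" for i l
  proof -
    have "\<bar>layered l i\<bar> \<le> (\<Sum>x\<in>V \<times> {1..d}. \<bar>layered (snd x) (fst x)\<bar>)"
      using that finite_V member_le_sum[of "(i, l)" "V \<times> {1..d}" "\<lambda>x. \<bar>layered (snd x) (fst x)\<bar>"] by simp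
    then show ?thesis by (simp add: Y_def)
  qed
  define top where "top x = (case x of (i, l) \<Rightarrow>
      if i = v then
        if l = z then 0
        else if l \<in> k ` {..<t} then \<zeta> (u (the_inv_into {..<t} k l)) - layered l (u (the_inv_into {..<t} k l))
        else - Y
      else if l = z then \<zeta> i else layered l i)" for x
  have top_z: "top (v, z) = 0" and top_other: "l \<noteq> z \<Longrightarrow> l \<notin> k ` {..<t} \<Longrightarrow> top (v, l) = - Y" for l
    by (simp_all add: top_def)
  have kz: "k a \<noteq> z" if "a < t" for a using k_range[OF that] z by simp
  have top_k: "top (v, k a) = \<zeta> (u a) - layered (k a) (u a)" if "a < t" for a
    using that kz[OF that] by (simp add: top_def the_inv_into_f_f[OF k_inj_on])
  have top_i: "top (i, l) = (if l = z then \<zeta> i else layered l i)" if "i \<noteq> v" for i l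
    using that by (simp add: top_def)
  obtain W :: "'v \<times> nat \<Rightarrow> nat" and Z where W: "\<forall>x\<in>V \<times> {1..d}. int (W x) = top x + Z"
    using nat_weights_exist[of "V \<times> {1..d}" top] finite_V by auto

  define lev where "lev e = (if v \<in> e then {c e, z} else {c e})" for e
  define q where "q e = (level_poly (lev e) e :: ('v \<times> nat, 'k) mpoly)" for e
  have "\<exists>a. (\<forall>l\<in>lev e. (\<Sum>i\<in>e. top (i, l)) = a) \<and> (\<forall>l\<in>{1..d} - lev e. (\<Sum>i\<in>e. top (i, l)) < a)"
    if e: "e \<in> F'" for e
    using F'_cases[OF e]
  proof (elim disjE conjE exE)
    assume eF: "e \<in> F" and ve: "v \<notin> e"
    have eE: "e \<in> E" using eF by (simp add: F_def)
    have cz: "c e \<noteq> z" using colour_range[OF eE] z by simp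
    have sum: "(\<Sum>i\<in>e. top (i, l)) = (if l = z then (\<Sum>i\<in>e. \<zeta> i) else (\<Sum>i\<in>e. layered l i))" for l
    proof -
      have "top (i, l) = (if l = z then \<zeta> i else layered l i)" if "i \<in> e" for i
        using that ve by (intro top_i) blast
      then show ?thesis by simp
    qed
    have "(\<Sum>i\<in>e. top (i, l)) < (\<Sum>i\<in>e. layered (c e) i)" if "l \<in> {1..d} - {c e}" for l
    proof (cases "l = z")
      case True
      have "(\<Sum>i\<in>e. \<zeta> i) \<le> 0" by (intro sum_nonpos) (rule \<zeta>_le)
      then show ?thesis using True sum layered_pos[OF eE] K_power_pos[of "p - c e"] by simp
    next
      case False
      then show ?thesis using sum layered_less[OF eE, of l] that by simp
    qed
    then show ?thesis using ve sum cz by (intro exI[of _ "\<Sum>i\<in>e. layered (c e) i"]) (simp add: lev_def)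
  next
    fix a assume a: "a < t" and ea: "e = {v, u a}" and ca: "c e = k a"
    have sum: "(\<Sum>i\<in>e. top (i, l)) = top (v, l) + top (u a, l)" for l
      using uv[OF a] ea by simp
    have lev: "lev e = {k a, z}" using ea ca by (simp add: lev_def)
    show ?thesis
    proof (intro exI[of _ "\<zeta> (u a)"] conjI ballI)
      fix l assume "l \<in> lev e"
      then show "(\<Sum>i\<in>e. top (i, l)) = \<zeta> (u a)"
        using kz[OF a] unfolding sum lev by (auto simp: top_z top_k[OF a] top_i[OF uv[OF a]])
    next
      fix l assume l: "l \<in> {1..d} - lev e"
      then have l': "l \<in> {1..d}" "l \<noteq> k a" "l \<noteq> z" by (auto simp: lev)
      have ul: "top (u a, l) = layered l (u a)" using l' uv[OF a] by (simp add: top_i)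
      show "(\<Sum>i\<in>e. top (i, l)) < \<zeta> (u a)"
      proof (cases "l \<in> k ` {..<t}")
        case True
        then obtain b where b: "b < t" "l = k b" by blast
        then have "b \<noteq> a" using l' by blast
        then show ?thesis
          using potential[OF b(1) a] unfolding sum ul unfolding b(2) top_k[OF b(1)] by simp
      next
        case False
        then show ?thesis
          using Y[OF uV[OF a] l'(1)] l' K_power_pos[of "p - k a"] unfolding sum ul by (simp add: top_other \<zeta>_u[OF a])
      qed
    qed
  qed
  then obtain a where a: "\<And>e l. e \<in> F' \<Longrightarrow> l \<in> lev e \<Longrightarrow> (\<Sum>i\<in>e. top (i, l)) = a e"
    "\<And>e l. e \<in> F' \<Longrightarrow> l \<in> {1..d} - lev e \<Longrightarrow> (\<Sum>i\<in>e. top (i, l)) < a e"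
    by metis
  have lev_sub: "lev e \<subseteq> {1..d}" "lev e \<noteq> {}" if "e \<in> F'" for e
    using colour_range[of e] that FE z by (auto simp: lev_def)
  let ?w = "\<lambda>e. nat (a e + 2 * Z)"
  have init: "wless W (Suc (?w e)) (f e)" "wpart W (?w e) (f e) = q e" if e: "e \<in> F'" for e
    unfolding f_def q_def
    using LSS_poly_initial[OF W _ lev_sub[OF e] a[OF e]] e FE by auto

  \<comment> \<open>Second degeneration: on edges at \<open>v\<close> the colour wins against \<open>z\<close>, except for the colour \<open>\<kappa>\<close>, where
    \<open>z\<close> wins.  As colours are positive, \<open>\<kappa> = 0\<close> means no exception.\<close>
  define W2 :: "nat \<Rightarrow> 'v \<times> nat \<Rightarrow> nat" where
    "W2 \<kappa> x = (if fst x \<noteq> v then 0 else if snd x = z then 1 else if snd x = \<kappa> then 0 else 2)" for \<kappa> x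
  define c2 where "c2 \<kappa> e = (if v \<in> e \<and> c e = \<kappa> then z else c e)" for \<kappa> e
  let ?w2 = "\<lambda>\<kappa> e. \<Sum>i\<in>e. W2 \<kappa> (i, c2 \<kappa> e)"
  have init2: "wless (W2 \<kappa>) (Suc (?w2 \<kappa> e)) (q e) \<and> wpart (W2 \<kappa>) (?w2 \<kappa> e) (q e) = level_poly {c2 \<kappa> e} e"
    if e: "e \<in> F'" for e \<kappa>
  proof -
    have "finite (lev e)" "{c2 \<kappa> e} \<subseteq> lev e" by (auto simp: lev_def c2_def)
    moreover have "(\<Sum>i\<in>e. W2 \<kappa> (i, l)) < ?w2 \<kappa> e" if l: "l \<in> lev e - {c2 \<kappa> e}" for l
    proof -
      obtain a where a: "a < t" "e = {v, u a}" "c e = k a"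
        using F'_cases[OF e] l by (auto simp: lev_def c2_def)
      have "(\<Sum>i\<in>e. W2 \<kappa> (i, l)) = W2 \<kappa> (v, l)" for l
        using a(2) uv[OF a(1)] by (simp add: W2_def)
      then show ?thesis using l a kz[OF a(1)] by (auto simp: lev_def c2_def W2_def split: if_splits)
    qed
    ultimately show ?thesis
      unfolding q_def using level_poly_top[of "lev e" "{c2 \<kappa> e}" "W2 \<kappa>" e "?w2 \<kappa> e"] by auto
  qed
  have proper2: "proper_colouring F' (c2 \<kappa>)" for \<kappa>
    unfolding proper_colouring_def
  proof (intro conjI ballI impI)
    fix e assume "e \<in> F'"
    then show "finite e" using FE edgeE by (metis finite.emptyI finite_insert subsetD)
  next
    fix e e' assume e: "e \<in> F'" "e' \<in> F'" "e \<noteq> e' \<and> c2 \<kappa> e = c2 \<kappa> e'"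
    have "c e \<noteq> z" "c e' \<noteq> z" using e FE colour_range[of e] colour_range[of e'] z by auto
    then have "c e = c e'" using e(3) by (auto simp: c2_def split: if_splits)
    then show "e \<inter> e' = {}" using e FE by (intro proper) auto
  qed
  have regular2: "regular_family (\<lambda>e. level_poly {c2 \<kappa> e} e :: ('v \<times> nat, 'k) mpoly) F'" for \<kappa>
    by (rule regular_family_colour_monomials[OF proper2])
  have regular_q: "regular_family q F'"
    by (rule regular_family_lift[where w = "?w2 0" and W = "W2 0", OF finF' _ _ regular2[of 0]])
      (simp_all add: init2)
  have degenerates_f: "degenerates W (idl.span (f ` F')) (idl.span (q ` F'))"
    using finF' init regular_q by (rule degenerates_family[where w = ?w])
  have degenerates_q: "degenerates (W2 \<kappa>) (idl.span (q ` F')) (idl.span ((\<lambda>e. level_poly {c2 \<kappa> e} e) ` F'))" for \<kappa>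
    by (rule degenerates_family[where w = "?w2 \<kappa>", OF finF' _ _ regular2]) (simp_all add: init2)

  have nzd_pvar: "nzd_mod (idl.span (q ` F')) (pvar (u b, k b))" if b: "b < t" for b
  proof (rule degenerates_nzd_mod[OF degenerates_q[of "k b"]])
    have hom: "homog (W2 (k b)) 0 (pvar (u b, k b) :: ('v \<times> nat, 'k) mpoly)"
      using homog_pvar[of "W2 (k b)" "(u b, k b)"] uv[OF b] by (simp add: W2_def)
    then show "wless (W2 (k b)) (Suc 0) (pvar (u b, k b) :: ('v \<times> nat, 'k) mpoly)"
      by (rule homog_imp_wless)
    have "c2 (k b) e \<noteq> k b" if e: "e \<in> F'" "u b \<in> e" for e
    proof (cases "c e = k b")
      case True
      then have "e = {v, u b}"
        using proper[of e "{v, u b}"] e FE uE[OF b] by (auto simp: k_def)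
      then show ?thesis using True kz[OF b] by (auto simp: c2_def)
    qed (use kz[OF b] in \<open>auto simp: c2_def\<close>)
    then show "nzd_mod (idl.span ((\<lambda>e. level_poly {c2 (k b) e} e) ` F'))
        (wpart (W2 (k b)) 0 (pvar (u b, k b) :: ('v \<times> nat, 'k) mpoly))"
      unfolding wpart_homog[OF hom] using nzd_mod_pvar_colour_monomials[OF proper2] by auto
  qed
  let ?A = "mat t t (\<lambda>(a, b). pvar (u a, k b) :: ('v \<times> nat, 'k) mpoly)"
  have pot_W: "int (W (u i, k j)) - int (W (u j, k j)) < \<zeta> (u i) - \<zeta> (u j)"
    if ij: "i < t" "j < t" "i \<noteq> j" for i j
  proof -
    have "k j \<in> {1..d}" using k_range[OF ij(2)] z by auto
    then have "int (W (u i, k j)) = layered (k j) (u i) + Z" "int (W (u j, k j)) = layered (k j) (u j) + Z"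
      using W ij uV uv kz[OF ij(2)] by (simp_all add: top_i)
    then show ?thesis using potential[of j i] ij by simp
  qed
  note det = det_initial_form[where x = "\<lambda>i j. (u i, k j)" and \<zeta> = "\<lambda>i. \<zeta> (u i)", OF pot_W]
  have nzd_det: "nzd_mod (idl.span (f ` F')) (det ?A)"
  proof (rule degenerates_nzd_mod[OF degenerates_f det(1)])
    have "wpart W (\<Sum>i<t. W (u i, k i)) (det ?A) = (\<Prod>i<t. pvar (u i, k i))"
      by (rule det(2))
    moreover have "nzd_mod (idl.span (q ` F')) (\<Prod>i<t. pvar (u i, k i))"
      by (intro nzd_mod_prod nzd_pvar) simp
    ultimately show "nzd_mod (idl.span (q ` F')) (wpart W (\<Sum>i<t. W (u i, k i)) (det ?A))"
      by simp
  qed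
  have "k a \<in> {1..d}" if "a < t" for a using k_range[OF that] z by auto
  then show ?thesis
    unfolding F'
    using prime nzd_det vF uv k_inj_on
    unfolding f_def F'_def F_def
    by (intro prime_mod_attach_vertex) auto
qed

text \<open>The induction over the vertices starts without edges: there the ideal is zero, and the polynomial ring
is a domain.\<close>

theorem LSS_prime:
  assumes d: "p < d"
  shows "prime_mod (idl.span ((LSS_poly d :: 'v set \<Rightarrow> ('v \<times> nat, 'k::field) mpoly) ` E))"
proof -
  let ?f = "LSS_poly d :: 'v set \<Rightarrow> ('v \<times> nat, 'k) mpoly"
  have step: "prime_mod (idl.span (?f ` {e \<in> E. e \<subseteq> U}))" if "finite U" "U \<subseteq> V" for U
    using that
  proof (induction U)
    case empty
    have no_edges: "{e \<in> E. e \<subseteq> {}} = {}" by (auto elim: edgeE)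
    show ?case unfolding no_edges by (simp add: prime_mod_def)
  next
    case (insert v U)
    then show ?case using LSS_prime_insert_vertex[of d d U v] d by auto
  qed
  have "{e \<in> E. e \<subseteq> V} = E" by (auto elim: edgeE)
  then show ?thesis using step[OF finite_V order_refl] by simp
qed

end

section \<open>Passing to the polynomial ring in finitely many variables\<close>

definition drop_vars :: "'x set \<Rightarrow> ('x, 'k::field) mpoly \<Rightarrow> ('x, 'k) mpoly" where
  "drop_vars X = restr (\<lambda>m. keys m \<subseteq> X)"

lemma drop_vars_mult: "drop_vars X (p * q) = drop_vars X p * drop_vars X q"
  unfolding drop_vars_def by (rule restr_mult_hom) (simp add: keys_add_nat)

lemma drop_vars_in_carrier: "drop_vars X p \<in> carrier (poly_ring X)"
  by (auto simp: drop_vars_def poly_ring_def keys_restr)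

lemma drop_vars_carrier: "p \<in> carrier (poly_ring X) \<Longrightarrow> drop_vars X p = p"
  unfolding drop_vars_def by (rule restr_eq_self) (simp add: poly_ring_def)

text \<open>A representation of \<open>p\<close> with coefficients in all variables becomes one over \<open>X\<close> by setting the variables
outside \<open>X\<close> to zero, which changes neither \<open>p\<close> nor the generators.\<close>

lemma genideal_poly_ring:
  fixes S :: "('x, 'k::field) mpoly set"
  assumes S: "S \<subseteq> carrier (poly_ring X)"
  shows "genideal (poly_ring X) S = carrier (poly_ring X) \<inter> idl.span S"
proof -
  let ?R = "poly_ring X :: ('x, 'k) mpoly ring"
  interpret R: cring ?R by (rule cring_poly_ring)
  have ops: "x \<otimes>\<^bsub>?R\<^esub> y = x * y" "x \<oplus>\<^bsub>?R\<^esub> y = x + y" "\<zero>\<^bsub>?R\<^esub> = 0" for x y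
    by (simp_all add: poly_ring_def)
  have minus: "\<ominus>\<^bsub>?R\<^esub> x = - x" if x: "x \<in> carrier ?R" for x
  proof (rule R.minus_equality)
    show "- x \<oplus>\<^bsub>?R\<^esub> x = \<zero>\<^bsub>?R\<^esub>" by (simp add: ops)
    show "x \<in> carrier ?R" by (rule x)
    show "- x \<in> carrier ?R" using x by (simp add: poly_ring_def)
  qed
  have "ideal (carrier ?R \<inter> idl.span S) ?R"
  proof (rule idealI)
    show "ring ?R" by (rule R.ring_axioms)
    show "subgroup (carrier ?R \<inter> idl.span S) (add_monoid ?R)"
    proof (rule R.add.subgroupI)
      show "carrier ?R \<inter> idl.span S \<noteq> {}" using R.zero_closed idl.span_zero ops(3) by fastforce
      show "\<ominus>\<^bsub>?R\<^esub> x \<in> carrier ?R \<inter> idl.span S" if "x \<in> carrier ?R \<inter> idl.span S" for x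
        using that R.a_inv_closed[of x] by (simp add: minus idl.span_neg)
      show "x \<oplus>\<^bsub>?R\<^esub> y \<in> carrier ?R \<inter> idl.span S"
        if "x \<in> carrier ?R \<inter> idl.span S" "y \<in> carrier ?R \<inter> idl.span S" for x y
        using that R.a_closed[of x y] by (simp add: ops idl.span_add)
    qed simp
    show "y \<otimes>\<^bsub>?R\<^esub> x \<in> carrier ?R \<inter> idl.span S"
      "x \<otimes>\<^bsub>?R\<^esub> y \<in> carrier ?R \<inter> idl.span S"
      if "x \<in> carrier ?R \<inter> idl.span S" "y \<in> carrier ?R" for x y
      using that R.m_closed[of x y] R.m_closed[of y x]
      by (simp_all add: ops idl.span_scale span_mult_right)
  qed
  then have "genideal ?R S \<subseteq> carrier ?R \<inter> idl.span S"
    by (rule R.genideal_minimal) (use S idl.span_superset in blast)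
  moreover have "drop_vars X x \<in> genideal ?R S" if "x \<in> idl.span S" for x
    using that
  proof (induction rule: idl.span_induct_alt)
    interpret I: ideal "genideal ?R S" ?R by (rule R.genideal_ideal[OF S])
    case base
    show ?case using I.zero_closed by (simp add: ops drop_vars_def)
  next
    interpret I: ideal "genideal ?R S" ?R by (rule R.genideal_ideal[OF S])
    case (step a s x)
    have "drop_vars X a * s \<in> genideal ?R S"
      using I.I_l_closed[OF _ drop_vars_in_carrier] R.genideal_self[OF S] step.hyps
      by (simp add: ops subset_iff)
    moreover have "drop_vars X (a * s + x) = drop_vars X a * s + drop_vars X x"
      using S step.hyps drop_vars_mult[of X a s] drop_vars_carrier[of s X]
      by (auto simp: drop_vars_def restr_add)
    ultimately show ?case using I.a_closed[OF _ step.IH] by (simp add: ops)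
  qed
  then have "carrier ?R \<inter> idl.span S \<subseteq> genideal ?R S" using drop_vars_carrier by fastforce
  ultimately show ?thesis by blast
qed

text \<open>Edge polynomials have no constant term.\<close>

lemma one_notin_span_LSS:
  assumes "simple_graph V E"
  shows "(1 :: ('v \<times> nat, 'k::field) mpoly) \<notin> idl.span (LSS_poly d ` E)"
proof
  let ?P = "\<lambda>m :: 'v \<times> nat \<Rightarrow>\<^sub>0 nat. m = 0"
  have hom: "restr ?P (a * b) = restr ?P a * restr ?P b" for a b :: "('v \<times> nat, 'k) mpoly"
    by (rule restr_mult_hom) (simp add: keys_add_nat flip: keys_eq_empty)
  have var: "restr ?P (pvar x :: ('v \<times> nat, 'k) mpoly) = 0" for x
  proof (rule restr_eq_zero)
    have "Poly_Mapping.single x (1::nat) \<noteq> 0"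
      by (metis Poly_Mapping.lookup_single_eq Poly_Mapping.lookup_zero zero_neq_one)
    then show "m \<noteq> 0" if "m \<in> keys (pvar x :: ('v \<times> nat, 'k) mpoly)" for m
      using that by (simp add: pvar_def)
  qed
  have zero: "restr ?P (LSS_poly d e) = (0 :: ('v \<times> nat, 'k) mpoly)" if "e \<in> E" for e
  proof -
    have "\<exists>i\<in>V. \<exists>j\<in>V. i \<noteq> j \<and> e = {i, j}"
      using assms that by (simp add: simple_graph_def)
    then obtain i j where ij: "i \<noteq> j" "e = {i, j}" by (elim bexE conjE)
    have "(\<Prod>i\<in>e. pvar (i, l)) = pvar (i, l) * (pvar (j, l) :: ('v \<times> nat, 'k) mpoly)" for l
      using ij by simp
    then have "restr ?P (\<Prod>i\<in>e. pvar (i, l) :: ('v \<times> nat, 'k) mpoly) = 0" for l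
      by (simp add: hom var)
    then show ?thesis by (simp add: LSS_poly_def restr_sum)
  qed
  assume "(1 :: ('v \<times> nat, 'k) mpoly) \<in> idl.span (LSS_poly d ` E)"
  then have "restr ?P (1 :: ('v \<times> nat, 'k) mpoly) = 0"
  proof (induction rule: idl.span_induct_alt)
    case (step c x y)
    then show ?case using zero by (auto simp: restr_add hom)
  qed simp
  moreover have "restr ?P (1 :: ('v \<times> nat, 'k) mpoly) = 1" by (rule restr_eq_self) simp
  ultimately show False by simp
qed

theorem LSS_ideal_radical_complete_intersection_prime:
  fixes V :: "'v::linorder set"
  assumes "simple_graph V E" and "pmd E \<le> d"
  shows "radical_ideal (LSS_ideal V E d) (LSS_ring V d :: ('v \<times> nat, 'k::field) mpoly ring)
    \<and> complete_intersection (LSS_ideal V E d) (LSS_ring V d :: ('v \<times> nat, 'k) mpoly ring)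
    \<and> (pmd E + 1 \<le> d \<longrightarrow>
         primeideal (LSS_ideal V E d) (LSS_ring V d :: ('v \<times> nat, 'k) mpoly ring))"
proof -
  let ?R = "LSS_ring V d :: ('v \<times> nat, 'k) mpoly ring"
  let ?f = "LSS_poly d :: 'v set \<Rightarrow> ('v \<times> nat, 'k) mpoly"
  let ?I = "LSS_ideal V E d :: ('v \<times> nat, 'k) mpoly set"
  interpret R: cring ?R unfolding LSS_ring_def by (rule cring_poly_ring)
  obtain c w K where "positive_edge_colouring V E (pmd E) c w K"
    using positive_edge_colouring_exists[OF assms(1)] by blast
  then interpret positive_edge_colouring "V" E "pmd E" c w K .
  have gens: "?f ` E \<subseteq> carrier ?R" using LSS_poly_in_carrier[OF assms(1)] by blast
  have gen: "genideal ?R S = carrier ?R \<inter> idl.span S" if "S \<subseteq> carrier ?R" for S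
    using that unfolding LSS_ring_def by (rule genideal_poly_ring)
  have I: "?I = carrier ?R \<inter> idl.span (?f ` E)"
    unfolding LSS_ideal_def by (rule gen[OF gens])
  have ideal: "ideal ?I ?R" unfolding LSS_ideal_def by (rule R.genideal_ideal[OF gens])
  have proper: "carrier ?R \<noteq> ?I"
    using one_notin_span_LSS[OF assms(1), of d] R.one_closed
    unfolding I by (auto simp: LSS_ring_def poly_ring_def)
  have mult: "a \<otimes>\<^bsub>?R\<^esub> b = a * b" for a b by (simp add: LSS_ring_def poly_ring_def)
  have power: "a [^]\<^bsub>?R\<^esub> (m::nat) = a ^ m" for a m
  proof (induction m)
    case 0
    have "\<one>\<^bsub>?R\<^esub> = 1" by (simp add: LSS_ring_def poly_ring_def)
    then show ?case by simp
  next
    case (Suc m)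
    then show ?case by (simp add: mult mult.commute)
  qed

  have "radical_of ?R ?I = ?I"
  proof (intro equalityI subsetI)
    fix a assume "a \<in> radical_of ?R ?I"
    then obtain m :: nat where "a \<in> carrier ?R" "a ^ m \<in> idl.span (?f ` E)"
      by (auto simp: radical_of_def power I)
    then show "a \<in> ?I"
      using LSS_regular_radical(2)[OF assms(2), where 'k = 'k] by (auto simp: I radical_mod_def)
  next
    fix a assume "a \<in> ?I"
    moreover have "a [^]\<^bsub>?R\<^esub> (1::nat) = a" by (simp only: power power_one_right)
    ultimately have "a \<in> carrier ?R" "a [^]\<^bsub>?R\<^esub> (1::nat) \<in> ?I" by (simp_all only:) (simp add: I)
    then show "a \<in> radical_of ?R ?I" unfolding radical_of_def by blast
  qed
  then have "radical_ideal ?I ?R" using ideal by (simp add: radical_ideal_def)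

  moreover have "complete_intersection ?I ?R"
  proof -
    obtain es where es: "set es = E" "distinct es" using finite_E by (metis finite_distinct_list)
    have "regular_sequence ?R (map ?f es)"
      unfolding regular_sequence_def
    proof (intro conjI allI impI ballI)
      show "set (map ?f es) \<subseteq> carrier ?R" using gens es by simp
      show "genideal ?R (set (map ?f es)) \<noteq> carrier ?R"
        using proper es unfolding LSS_ideal_def by simp
      fix i a assume i: "i < length (map ?f es)" and a: "a \<in> carrier ?R"
        and fa: "map ?f es ! i \<otimes>\<^bsub>?R\<^esub> a \<in> genideal ?R (set (take i (map ?f es)))"
      have "es ! i \<notin> set (take i es)"
        using es(2) i by (auto simp: in_set_conv_nth nth_eq_iff_index_eq)
      then have sub: "es ! i \<in> E" "set (take i es) \<subseteq> E - {es ! i}"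
        using es(1) i set_take_subset[of i es] by auto
      then have nzd: "nzd_mod (idl.span (?f ` set (take i es))) (?f (es ! i))"
        using LSS_regular_radical(1)[OF assms(2), where 'k = 'k] unfolding regular_family_def by blast
      have "?f ` set (take i es) \<subseteq> carrier ?R" using sub gens by blast
      then have "genideal ?R (set (take i (map ?f es))) = carrier ?R \<inter> idl.span (?f ` set (take i es))"
        using gen by (simp add: take_map)
      then show "a \<in> genideal ?R (set (take i (map ?f es)))"
        using fa a nzd i by (simp add: mult nzd_mod_def)
    qed
    moreover have "?I = genideal ?R (set (map ?f es))" using es by (simp add: LSS_ideal_def)
    ultimately show ?thesis unfolding complete_intersection_def by blast
  qed

  moreover have "primeideal ?I ?R" if d: "d \<ge> pmd E + 1"
  proof (rule primeidealI[OF ideal R.cring_axioms proper])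
    fix a b assume "a \<in> carrier ?R" "b \<in> carrier ?R" "a \<otimes>\<^bsub>?R\<^esub> b \<in> ?I"
    then show "a \<in> ?I \<or> b \<in> ?I"
      using LSS_prime[of d, where 'k = 'k] d by (auto simp: I mult prime_mod_def)
  qed
  ultimately show ?thesis by blast
qed

theorem theorem1p3:
  fixes n d :: nat and E :: "nat set set"
  assumes "simple_graph {1..n} E" and "d \<ge> 1" and "d \<ge> pmd E"
  shows "radical_ideal (LSS_ideal {1..n} E d) (LSS_ring {1..n} d :: (nat \<times> nat, 'k::field) mpoly ring)
    \<and> complete_intersection (LSS_ideal {1..n} E d) (LSS_ring {1..n} d :: (nat \<times> nat, 'k) mpoly ring)
    \<and> (d \<ge> pmd E + 1 \<longrightarrow>
         primeideal (LSS_ideal {1..n} E d) (LSS_ring {1..n} d :: (nat \<times> nat, 'k) mpoly ring))"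
  using LSS_ideal_radical_complete_intersection_prime[OF assms(1,3)] .

end
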